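(* Let $n$ be a positive integer, let $F$ be a finite group, and let $G$ be a finitely generated group such that $\mathrm{Con}(G)=\mathrm{Con}(\mathbb{Z}^n\times F)$. Then $G\cong\mathbb{Z}^n\times F$.
   Context: Let $G$ be a finitely generated group. Given a finite generating sequence $\mathfrak g=(g_1,\dots,g_n)$ of $G$ and a finite (indexed) partition $\mathcal E=\{E_1,\dots,E_m\}$ of $G$ into nonempty, pairwise disjoint subsets, a configuration corresponding to $(\mathfrak g,\mathcal E)$ is an $(n+1)$-tuple $C=(c_0,c_1,\dots,c_n)$ with $1\le c_i\le m$ for each $i$ such that there is $x\in G$ with $x\in E_{c_0}$ and $g_ix\in E_{c_i}$ for each $1\le i\le n$. The set of all configurations corresponding to $(\mathfrak g,\mathcal E)$ is denoted $\mathrm{Con}(\mathfrak g,\mathcal E)$, and $\mathrm{Con}(G)$ denotes the set of all $\mathrm{Con}(\mathfrak g,\mathcal E)$ as $\mathfrak g$ runs over the finite generating sequences of $G$ and $\mathcal E$ over the finite partitions of $G$. *)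

theory Defs
  imports "HOL-Algebra.Product_Groups" "HOL-Library.Disjoint_Sets"
begin

definition generating_sequence :: "('a, 'b) monoid_scheme \<Rightarrow> 'a list \<Rightarrow> bool"
  where "generating_sequence G gs \<longleftrightarrow>
    set gs \<subseteq> carrier G \<and> generate G (set gs) = carrier G"

definition finitely_generated_group :: "('a, 'b) monoid_scheme \<Rightarrow> bool"
  where "finitely_generated_group G \<longleftrightarrow> group G \<and> (\<exists>gs. generating_sequence G gs)"

(* Only the values E 1, ..., E m matter. *)
definition indexed_partition :: "('a, 'b) monoid_scheme \<Rightarrow> nat \<Rightarrow> (nat \<Rightarrow> 'a set) \<Rightarrow> bool"
  where "indexed_partition G m E \<longleftrightarrow>
    (\<Union>i\<in>{1..m}. E i) = carrier G \<and>
    (\<forall>i\<in>{1..m}. E i \<noteq> {}) \<and>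
    disjoint_family_on E {1..m}"

(* The tuple (c_0, ..., c_n) is the list cs with cs ! i = c_i.  The generators
   g_1, ..., g_n are numbered from 1, so g_i is gs ! (i - 1). *)
definition configuration ::
    "('a, 'b) monoid_scheme \<Rightarrow> 'a list \<Rightarrow> nat \<Rightarrow> (nat \<Rightarrow> 'a set) \<Rightarrow> nat list \<Rightarrow> bool"
  where "configuration G gs m E cs \<longleftrightarrow>
    length cs = length gs + 1 \<and>
    (\<forall>i\<in>{0..length gs}. cs ! i \<in> {1..m}) \<and>
    (\<exists>x\<in>carrier G. x \<in> E (cs ! 0) \<and>
      (\<forall>i\<in>{1..length gs}. gs ! (i - 1) \<otimes>\<^bsub>G\<^esub> x \<in> E (cs ! i)))"

definition configurations ::
    "('a, 'b) monoid_scheme \<Rightarrow> 'a list \<Rightarrow> nat \<Rightarrow> (nat \<Rightarrow> 'a set) \<Rightarrow> nat list set"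
  where "configurations G gs m E = {cs. configuration G gs m E cs}"

definition Con :: "('a, 'b) monoid_scheme \<Rightarrow> nat list set set"
  where "Con G = {configurations G gs m E | gs m E.
    generating_sequence G gs \<and> indexed_partition G m E}"

definition int_power_group :: "nat \<Rightarrow> (nat \<Rightarrow> int) monoid"
  where "int_power_group n = product_group {1..n} (\<lambda>_. integer_group)"

end

theory Submission
  imports Defs "HOL-Algebra.Multiplicative_Group"
begin

text \<open>A finite colouring of \<open>G\<close> is a partition, and \<open>Con G \<subseteq> Con H\<close> turns it into a colouring of \<open>H\<close> with
  the same local patterns along some generating sequence. Giving finitely many points of \<open>G\<close> private
  colours shows that any finite set of words that are pairwise distinct in \<open>G\<close> is pairwise distinct for
  suitable generators of \<open>H\<close>, so laws and cardinality bounds on word values pass from \<open>H\<close> to \<open>G\<close>;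
  colouring by a finite quotient shows that \<open>G\<close> and \<open>H\<close> have the same finite quotients.

  For \<open>H = \<int>\<^sup>n \<times> F\<close> and \<open>k\<close> a multiple of \<open>|F|\<close>, the law transfer makes \<open>x \<mapsto> x\<^sup>k\<close> a homomorphism from \<open>G\<close>
  into its centre, and \<open>G/G\<^sup>k\<close> finite. Choose \<open>k\<close> such that moreover \<open>G\<^sup>k\<close> is torsion free, hence free
  abelian. Comparing finite quotients gives \<open>G/G\<^sup>K \<cong> (\<int>/K)\<^sup>n \<times> F\<close> for \<open>K = k\<^sup>2\<close>. Its \<open>F\<close>-component
  together with \<open>x \<mapsto> x\<^sup>k\<close> is an isomorphism \<open>G \<cong> G\<^sup>k \<times> F\<close>, and the rank of \<open>G\<^sup>k\<close> is \<open>n\<close> by counting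
  \<open>G/G\<^sup>K\<close>.\<close>

section \<open>Transfer along configurations\<close>

text \<open>The configuration seen from the point \<open>x\<close>, with cell indices replaced by
  colours of an arbitrary type. Colours can then carry information, such as group elements or values
  in a finite quotient.\<close>

definition color_pattern :: "('a, 'b) monoid_scheme \<Rightarrow> 'a list \<Rightarrow> ('a \<Rightarrow> 'c) \<Rightarrow> 'a \<Rightarrow> 'c list"
  where "color_pattern G gs \<chi> x = \<chi> x # map (\<lambda>g. \<chi> (g \<otimes>\<^bsub>G\<^esub> x)) gs"

lemma color_pattern_eqD:
  assumes "color_pattern G gs \<chi> x = color_pattern H hs \<chi>' y"
  shows "\<chi> x = \<chi>' y"
    and "i < length gs \<Longrightarrow> \<chi> (gs ! i \<otimes>\<^bsub>G\<^esub> x) = \<chi>' (hs ! i \<otimes>\<^bsub>H\<^esub> y)"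
    and "length gs = length hs"
proof -
  from assms have *: "map (\<lambda>g. \<chi> (g \<otimes>\<^bsub>G\<^esub> x)) gs = map (\<lambda>h. \<chi>' (h \<otimes>\<^bsub>H\<^esub> y)) hs"
    by (simp add: color_pattern_def)
  then show len: "length gs = length hs"
    by (rule map_eq_imp_length_eq)
  show "\<chi> x = \<chi>' y"
    using assms by (simp add: color_pattern_def)
  show "\<chi> (gs ! i \<otimes>\<^bsub>G\<^esub> x) = \<chi>' (hs ! i \<otimes>\<^bsub>H\<^esub> y)" if "i < length gs"
    using that len arg_cong[OF *, of "\<lambda>l. l ! i"] by simp
qed

text \<open>Disjointness of the cells makes \<open>idx\<close> the only index function on the
  carrier, so the point witnessing a configuration determines all its entries.\<close>

lemma configurations_eq_color_patterns:
  assumes "group G" "set gs \<subseteq> carrier G" "indexed_partition G m E"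
    and idx: "\<And>x. x \<in> carrier G \<Longrightarrow> idx x \<in> {1..m} \<and> x \<in> E (idx x)"
  shows "configurations G gs m E = color_pattern G gs idx ` carrier G"
proof -
  interpret group G by fact
  have disj: "disjoint_family_on E {1..m}"
    using assms(3) by (simp add: indexed_partition_def)
  have mem: "z \<in> E i \<longleftrightarrow> i = idx z" if "z \<in> carrier G" "i \<in> {1..m}" for z i
    using disj idx[OF that(1)] that(2) unfolding disjoint_family_on_def by blast
  have gcl: "gs ! i \<otimes>\<^bsub>G\<^esub> x \<in> carrier G" if "i < length gs" "x \<in> carrier G" for i x
    using assms(2) that nth_mem by blast
  show ?thesis
  proof (intro equalityI subsetI)
    fix cs assume "cs \<in> configurations G gs m E"
    then obtain x where len: "length cs = length gs + 1"
      and rng: "\<And>i. i \<le> length gs \<Longrightarrow> cs ! i \<in> {1..m}"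
      and x: "x \<in> carrier G" "x \<in> E (cs ! 0)"
      and xs: "\<And>i. i \<in> {1..length gs} \<Longrightarrow> gs ! (i - 1) \<otimes>\<^bsub>G\<^esub> x \<in> E (cs ! i)"
      by (auto simp: configurations_def configuration_def)
    have "cs ! i = color_pattern G gs idx x ! i" if "i < length cs" for i
    proof (cases i)
      case 0
      then show ?thesis
        using mem[of x "cs ! 0"] x rng[of 0] by (simp add: color_pattern_def)
    next
      case (Suc j)
      then have j: "j < length gs"
        using that len by simp
      have "gs ! j \<otimes>\<^bsub>G\<^esub> x \<in> E (cs ! i)"
        using xs[of i] j Suc by simp
      then show ?thesis
        using mem[of "gs ! j \<otimes>\<^bsub>G\<^esub> x" "cs ! i"] gcl[OF j x(1)] rng[of i] j Suc
        by (simp add: color_pattern_def)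
    qed
    then have "cs = color_pattern G gs idx x"
      using len by (intro nth_equalityI) (auto simp: color_pattern_def)
    then show "cs \<in> color_pattern G gs idx ` carrier G"
      using x by blast
  next
    fix cs assume "cs \<in> color_pattern G gs idx ` carrier G"
    then obtain x where x: "x \<in> carrier G" and cs: "cs = color_pattern G gs idx x"
      by blast
    have nth: "cs ! Suc j = idx (gs ! j \<otimes>\<^bsub>G\<^esub> x)" if "j < length gs" for j
      using that cs by (simp add: color_pattern_def)
    have "cs ! i \<in> {1..m}" if "i \<le> length gs" for i
    proof (cases i)
      case 0
      then show ?thesis using idx[OF x] cs by (simp add: color_pattern_def)
    next
      case (Suc j)
      then show ?thesis using idx[OF gcl[of j x]] x that nth[of j] by simp
    qed
    moreover have "gs ! (i - 1) \<otimes>\<^bsub>G\<^esub> x \<in> E (cs ! i)" if "i \<in> {1..length gs}" for i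
    proof -
      obtain j where "i = Suc j" "j < length gs"
        using \<open>i \<in> {1..length gs}\<close> by (cases i) auto
      then show ?thesis
        using idx[OF gcl[of j x]] x nth[of j] by simp
    qed
    moreover have "x \<in> E (cs ! 0)" "length cs = length gs + 1"
      using idx[OF x] cs by (simp_all add: color_pattern_def)
    ultimately show "cs \<in> configurations G gs m E"
      using x unfolding configurations_def configuration_def by auto
  qed
qed

text \<open>The colour classes, numbered by a bijection \<open>b\<close>, form a partition, since
  only colours that occur are numbered. Its configuration set is also one of \<open>H\<close>, and
  decoding the numbers turns the cells in \<open>H\<close> into a colouring.\<close>

lemma Con_color_transfer:
  fixes \<chi> :: "'a \<Rightarrow> 'c"
  assumes "Con G \<subseteq> Con H" "group G" "group H" "generating_sequence G gs"
    and "finite (\<chi> ` carrier G)"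
  obtains hs \<chi>' where "generating_sequence H hs"
    "color_pattern G gs \<chi> ` carrier G = color_pattern H hs \<chi>' ` carrier H"
proof -
  define m where "m = card (\<chi> ` carrier G)"
  have "\<exists>b. bij_betw b (\<chi> ` carrier G) {1..m}"
    by (rule finite_same_card_bij[OF assms(5)]) (simp_all add: m_def)
  then obtain b where b: "bij_betw b (\<chi> ` carrier G) {1..m}" ..
  define E where "E i = {x \<in> carrier G. b (\<chi> x) = i}" for i
  have b_in: "b (\<chi> x) \<in> {1..m}" if "x \<in> carrier G" for x
    using bij_betwE[OF b] that by blast
  have part: "indexed_partition G m E"
    unfolding indexed_partition_def
  proof (intro conjI ballI)
    show "(\<Union>i\<in>{1..m}. E i) = carrier G"
      using b_in by (auto simp: E_def)
    show "disjoint_family_on E {1..m}"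
      by (auto simp: E_def disjoint_family_on_def)
    fix i assume "i \<in> {1..m}"
    then have "i \<in> b ` \<chi> ` carrier G"
      using b by (simp add: bij_betw_def)
    then show "E i \<noteq> {}"
      by (auto simp: E_def)
  qed
  have gs: "set gs \<subseteq> carrier G"
    using assms(4) by (simp add: generating_sequence_def)
  have confG: "configurations G gs m E = color_pattern G gs (b \<circ> \<chi>) ` carrier G"
    using b_in by (intro configurations_eq_color_patterns[OF assms(2) gs part]) (auto simp: E_def)
  have "configurations G gs m E \<in> Con G"
    using assms(4) part by (auto simp: Con_def)
  then have "configurations G gs m E \<in> Con H"
    using assms(1) by blast
  then obtain hs m' E' where hs: "generating_sequence H hs" "indexed_partition H m' E'"
    and conf: "configurations G gs m E = configurations H hs m' E'"
    by (auto simp: Con_def)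
  have "\<exists>i. i \<in> {1..m'} \<and> y \<in> E' i" if "y \<in> carrier H" for y
    using hs(2) that unfolding indexed_partition_def by blast
  then obtain idx where idx: "\<And>y. y \<in> carrier H \<Longrightarrow> idx y \<in> {1..m'} \<and> y \<in> E' (idx y)"
    by metis
  \<comment> \<open>\<open>c\<close> decodes numbers into colours. Applied entrywise to the equal
    sets of patterns, it restores \<open>\<chi>\<close> on \<open>G\<close> and defines the new
    colouring on \<open>H\<close>.\<close>
  define c where "c = inv_into (\<chi> ` carrier G) b"
  have hs_sub: "set hs \<subseteq> carrier H"
    using hs(1) by (simp add: generating_sequence_def)
  have eq: "color_pattern G gs (b \<circ> \<chi>) ` carrier G = color_pattern H hs idx ` carrier H"
    using configurations_eq_color_patterns[OF assms(3) hs_sub hs(2) idx] confG conf by simp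
  have cb: "c (b (\<chi> x)) = \<chi> x" if "x \<in> carrier G" for x
    using b that by (simp add: c_def bij_betw_inv_into_left)
  interpret G: group G by fact
  have "map c (color_pattern G gs (b \<circ> \<chi>) x) = color_pattern G gs \<chi> x" if "x \<in> carrier G" for x
    using that cb gs by (auto simp: color_pattern_def subset_iff)
  then have "map c ` color_pattern G gs (b \<circ> \<chi>) ` carrier G = color_pattern G gs \<chi> ` carrier G"
    by (simp add: image_image)
  moreover have "map c ` color_pattern H hs idx ` carrier H = color_pattern H hs (c \<circ> idx) ` carrier H"
    by (simp add: image_image color_pattern_def o_def)
  ultimately have "color_pattern G gs \<chi> ` carrier G = color_pattern H hs (c \<circ> idx) ` carrier H"
    using eq by simp
  with hs(1) show thesis
    by (rule that)
qed

section \<open>Formal words and the transfer of their values\<close>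

fun word_value :: "('a, 'b) monoid_scheme \<Rightarrow> 'a list \<Rightarrow> (nat \<times> bool) list \<Rightarrow> 'a"
  where
    "word_value G gs [] = \<one>\<^bsub>G\<^esub>"
  | "word_value G gs ((i, b) # w) =
      (if b then gs ! i else inv\<^bsub>G\<^esub> (gs ! i)) \<otimes>\<^bsub>G\<^esub> word_value G gs w"

text \<open>Words are formal so that one word can be evaluated in both groups; the bound keeps every
  lookup \<open>gs ! i\<close> inside the list.\<close>

definition word_in :: "nat \<Rightarrow> (nat \<times> bool) list \<Rightarrow> bool"
  where "word_in d w \<longleftrightarrow> set w \<subseteq> {..<d} \<times> UNIV"

lemma word_in_simps [simp]:
  "word_in d []"
  "word_in d ((i, b) # w) \<longleftrightarrow> i < d \<and> word_in d w"
  "word_in d (u @ v) \<longleftrightarrow> word_in d u \<and> word_in d v"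
  by (auto simp: word_in_def)

context group
begin

lemma word_value_closed:
  "set gs \<subseteq> carrier G \<Longrightarrow> word_in (length gs) w \<Longrightarrow> word_value G gs w \<in> carrier G"
  by (induction w) (auto simp: subset_iff)

lemma word_value_append:
  assumes "set gs \<subseteq> carrier G" "word_in (length gs) u" "word_in (length gs) v"
  shows "word_value G gs (u @ v) = word_value G gs u \<otimes> word_value G gs v"
  using assms(2)
proof (induction u)
  case Nil
  then show ?case using word_value_closed[OF assms(1,3)] by simp
next
  case (Cons a u)
  then show ?case
    using word_value_closed[OF assms(1)] assms by (cases a) (auto simp: m_assoc subset_iff)
qed

lemma generate_imp_word_value:
  assumes "set gs \<subseteq> carrier G" "x \<in> generate G (set gs)"
  shows "\<exists>w. word_in (length gs) w \<and> word_value G gs w = x"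
  using assms(2)
proof (induction rule: generate.induct)
  case one
  show ?case by (rule exI[of _ "[]"]) simp
next
  case (incl h)
  then obtain i where "i < length gs" "gs ! i = h" by (auto simp: in_set_conv_nth)
  then show ?case using incl assms by (intro exI[of _ "[(i, True)]"]) auto
next
  case (inv h)
  then obtain i where "i < length gs" "gs ! i = h" by (auto simp: in_set_conv_nth)
  then show ?case using inv assms by (intro exI[of _ "[(i, False)]"]) auto
next
  case (eng h1 h2)
  then obtain u v where "word_in (length gs) u" "word_value G gs u = h1"
    "word_in (length gs) v" "word_value G gs v = h2"
    by blast
  then show ?case using word_value_append[OF assms(1)] by (intro exI[of _ "u @ v"]) auto
qed

end

text \<open>Private colours in \<open>G\<close> act as signposts: a path in \<open>H\<close> that
  spells a word, started at a suitable point, sees at its end the colour naming the value of that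
  word in \<open>G\<close>. Hence the value in \<open>H\<close> determines the value in
  \<open>G\<close>.\<close>

lemma Con_word_transfer:
  assumes "Con G \<subseteq> Con H" "group G" "group H" "generating_sequence G gs"
    and "finite W" and W: "\<And>w. w \<in> W \<Longrightarrow> word_in (length gs) w"
  obtains hs where "generating_sequence H hs" "length hs = length gs"
    "\<And>v w. \<lbrakk>v \<in> W; w \<in> W; word_value H hs v = word_value H hs w\<rbrakk>
      \<Longrightarrow> word_value G gs v = word_value G gs w"
proof -
  interpret G: group G by fact
  interpret H: group H by fact
  have gs: "set gs \<subseteq> carrier G"
    using assms(4) by (simp add: generating_sequence_def)
  \<comment> \<open>Letters multiply from the left, so a path from the identity passes through the
    values of the suffixes of its word. Each of these finitely many points gets its own colour
    \<open>Some x\<close>; all other points share \<open>None\<close>.\<close>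
  define S where "S = insert \<one>\<^bsub>G\<^esub> (\<Union>w\<in>W. (\<lambda>k. word_value G gs (drop k w)) ` {..length w})"
  have "finite S"
    using \<open>finite W\<close> by (simp add: S_def)
  define \<chi> where "\<chi> x = (if x \<in> S then Some x else None)" for x
  have "\<chi> ` carrier G \<subseteq> insert None (Some ` S)"
    by (auto simp: \<chi>_def)
  then have fin: "finite (\<chi> ` carrier G)"
    using \<open>finite S\<close> finite_subset by blast
  obtain hs \<chi>' where hs: "generating_sequence H hs"
    and pat: "color_pattern G gs \<chi> ` carrier G = color_pattern H hs \<chi>' ` carrier H"
    using Con_color_transfer[OF assms(1-4) fin] by blast
  have hsc: "set hs \<subseteq> carrier H"
    using hs by (simp add: generating_sequence_def)
  \<comment> \<open>The base point \<open>y0\<close> shows the pattern of the identity of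
    \<open>G\<close>; it may differ from the identity of \<open>H\<close>.\<close>
  obtain y0 where y0: "y0 \<in> carrier H"
    and eq0: "color_pattern G gs \<chi> \<one>\<^bsub>G\<^esub> = color_pattern H hs \<chi>' y0"
    using pat G.one_closed by blast
  note len = color_pattern_eqD(3)[OF eq0]
  have \<chi>D: "z = x" if "\<chi> z = Some x" for x z
    using that by (simp add: \<chi>_def split: if_splits)
  have follow: "\<chi>' (word_value H hs w \<otimes>\<^bsub>H\<^esub> y0) = Some (word_value G gs w)"
    if "word_in (length gs) w" "\<And>k. word_value G gs (drop k w) \<in> S" for w
    using that
  proof (induction w)
    case Nil
    then show ?case
      using color_pattern_eqD(1)[OF eq0] y0 by (simp add: \<chi>_def S_def)
  next
    case (Cons a w)
    obtain i b where a: "a = (i, b)" by (cases a)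
    define y where "y = word_value H hs w \<otimes>\<^bsub>H\<^esub> y0"
    define x where "x = word_value G gs w"
    have w: "word_in (length gs) w" and i: "i < length gs"
      using Cons.prems(1) a by auto
    have y: "y \<in> carrier H" and x: "x \<in> carrier G"
      using w y0 len H.word_value_closed[OF hsc] G.word_value_closed[OF gs] by (auto simp: x_def y_def)
    have gi: "gs ! i \<in> carrier G" and hi: "hs ! i \<in> carrier H"
      using gs hsc i len by auto
    have IH: "\<chi>' y = Some x"
      unfolding x_def y_def using Cons.prems(2)[of "Suc k" for k]
      by (intro Cons.IH[OF w]) simp
    have inS: "word_value G gs (a # w) \<in> S"
      using Cons.prems(2)[of 0] by simp
    show ?case
    proof (cases b)
      case True
      \<comment> \<open>The pattern at \<open>y\<close> occurs somewhere in \<open>G\<close>, and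
        the private colour \<open>Some x\<close> leaves only the point \<open>x\<close>.\<close>
      obtain x1 where x1: "color_pattern G gs \<chi> x1 = color_pattern H hs \<chi>' y"
        using pat y by (metis image_iff)
      have "x1 = x"
        using color_pattern_eqD(1)[OF x1] IH \<chi>D by simp
      then have "\<chi>' (hs ! i \<otimes>\<^bsub>H\<^esub> y) = \<chi> (gs ! i \<otimes>\<^bsub>G\<^esub> x)"
        using color_pattern_eqD(2)[OF x1 i] by simp
      moreover have "\<chi> (gs ! i \<otimes>\<^bsub>G\<^esub> x) = Some (gs ! i \<otimes>\<^bsub>G\<^esub> x)"
        using inS a True by (simp add: \<chi>_def x_def)
      ultimately show ?thesis
        using a True y0 hi w len H.word_value_closed[OF hsc, of w] by (simp add: y_def x_def H.m_assoc)
    next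
      case False
      \<comment> \<open>For an inverse letter the pattern is read at the target \<open>z\<close>:
        its entry for generator \<open>i\<close> is the colour of \<open>y\<close>, which forces
        \<open>gs ! i\<close> times \<open>x1\<close> to be \<open>x\<close>.\<close>
      define z where "z = inv\<^bsub>H\<^esub> (hs ! i) \<otimes>\<^bsub>H\<^esub> y"
      have z: "z \<in> carrier H" "hs ! i \<otimes>\<^bsub>H\<^esub> z = y"
        using y hi by (simp_all add: z_def H.m_assoc[symmetric])
      obtain x1 where x1c: "x1 \<in> carrier G"
        and x1: "color_pattern G gs \<chi> x1 = color_pattern H hs \<chi>' z"
        using pat z(1) by (metis image_iff)
      have "gs ! i \<otimes>\<^bsub>G\<^esub> x1 = x"
        using color_pattern_eqD(2)[OF x1 i] z(2) IH \<chi>D by simp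
      then have "x1 = inv\<^bsub>G\<^esub> (gs ! i) \<otimes>\<^bsub>G\<^esub> x"
        using gi x1c x G.inv_solve_left by metis
      moreover have "\<chi> (inv\<^bsub>G\<^esub> (gs ! i) \<otimes>\<^bsub>G\<^esub> x) = Some (inv\<^bsub>G\<^esub> (gs ! i) \<otimes>\<^bsub>G\<^esub> x)"
        using inS a False by (simp add: \<chi>_def x_def)
      ultimately have "\<chi>' z = Some (inv\<^bsub>G\<^esub> (gs ! i) \<otimes>\<^bsub>G\<^esub> x)"
        using color_pattern_eqD(1)[OF x1] by simp
      then show ?thesis
        using a False y0 hi w len H.word_value_closed[OF hsc, of w]
        by (simp add: z_def y_def x_def H.m_assoc)
    qed
  qed
  have all: "\<chi>' (word_value H hs w \<otimes>\<^bsub>H\<^esub> y0) = Some (word_value G gs w)" if w: "w \<in> W" for w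
  proof (rule follow[OF W[OF w]])
    fix k
    have "word_value G gs (drop (min k (length w)) w) \<in> S"
      using w unfolding S_def by (intro insertI2 UN_I[OF w] imageI) simp
    then show "word_value G gs (drop k w) \<in> S"
      by (cases "k \<le> length w") (auto simp: min_def)
  qed
  show thesis
  proof (rule that[OF hs len[symmetric]])
    fix v w
    assume "v \<in> W" "w \<in> W" "word_value H hs v = word_value H hs w"
    then show "word_value G gs v = word_value G gs w"
      using all[of v] all[of w] by simp
  qed
qed

text \<open>When \<open>\<phi>\<close> itself is the colouring, left multiplication by a generator
  acts on colours as left multiplication by its image in \<open>Q\<close>. The patterns impose the
  same rule on the colouring of \<open>H\<close>, and the resulting action of \<open>H\<close> on
  colours is the wanted homomorphism.\<close>

lemma Con_finite_quotient_transfer: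
  assumes "Con G \<subseteq> Con H" "group G" "group H" "generating_sequence G gs"
    and "group Q" "finite (carrier Q)" "\<phi> \<in> hom G Q" "\<phi> ` carrier G = carrier Q"
  shows "\<exists>\<psi>\<in>hom H Q. \<psi> ` carrier H = carrier Q"
proof -
  interpret G: group G by fact
  interpret H: group H by fact
  interpret Q: group Q by fact
  have gs: "set gs \<subseteq> carrier G"
    using assms(4) by (simp add: generating_sequence_def)
  obtain hs \<chi> where hs: "generating_sequence H hs"
    and pat: "color_pattern G gs \<phi> ` carrier G = color_pattern H hs \<chi> ` carrier H"
    using Con_color_transfer[OF assms(1-4), of \<phi>] assms(6,8) by auto
  have hsc: "set hs \<subseteq> carrier H" "generate H (set hs) = carrier H"
    using hs by (simp_all add: generating_sequence_def)
  have \<chi>_image: "\<chi> ` carrier H = carrier Q"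
  proof -
    have "hd ` color_pattern G gs \<phi> ` carrier G = hd ` color_pattern H hs \<chi> ` carrier H"
      using pat by simp
    then show ?thesis
      by (simp add: image_image color_pattern_def assms(8))
  qed
  then have \<chi>c: "\<chi> y \<in> carrier Q" if "y \<in> carrier H" for y
    using that by blast
  \<comment> \<open>The factor is the image under \<open>\<phi>\<close> of the generator of
    \<open>G\<close> at the same position; it is independent of \<open>y\<close> because every
    pattern in \<open>H\<close> occurs in \<open>G\<close>.\<close>
  have act: "\<exists>q\<in>carrier Q. \<forall>y\<in>carrier H. \<chi> (h \<otimes>\<^bsub>H\<^esub> y) = q \<otimes>\<^bsub>Q\<^esub> \<chi> y" if h: "h \<in> set hs" for h
  proof -
    obtain i where i: "i < length hs" "hs ! i = h"
      using h by (auto simp: in_set_conv_nth)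
    obtain y0 where "color_pattern G gs \<phi> \<one>\<^bsub>G\<^esub> = color_pattern H hs \<chi> y0"
      using pat G.one_closed by blast
    then have "length gs = length hs"
      by (rule color_pattern_eqD)
    then have gi: "gs ! i \<in> carrier G" "i < length gs"
      using gs i by auto
    have "\<chi> (h \<otimes>\<^bsub>H\<^esub> y) = \<phi> (gs ! i) \<otimes>\<^bsub>Q\<^esub> \<chi> y" if y: "y \<in> carrier H" for y
    proof -
      obtain x where x: "x \<in> carrier G" "color_pattern G gs \<phi> x = color_pattern H hs \<chi> y"
        using pat y by (metis image_iff)
      have "\<chi> (h \<otimes>\<^bsub>H\<^esub> y) = \<phi> (gs ! i \<otimes>\<^bsub>G\<^esub> x)"
        using color_pattern_eqD(2)[OF x(2) gi(2)] i by simp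
      also have "\<dots> = \<phi> (gs ! i) \<otimes>\<^bsub>Q\<^esub> \<phi> x"
        using hom_mult[OF assms(7)] gi x by blast
      finally show ?thesis
        using color_pattern_eqD(1)[OF x(2)] by simp
    qed
    then show ?thesis
      using gi hom_in_carrier[OF assms(7)] by blast
  qed
  have all: "\<exists>q\<in>carrier Q. \<forall>y\<in>carrier H. \<chi> (z \<otimes>\<^bsub>H\<^esub> y) = q \<otimes>\<^bsub>Q\<^esub> \<chi> y"
    if "z \<in> generate H (set hs)" for z
    using that
  proof (induction rule: generate.induct)
    case one
    show ?case using \<chi>c by (intro bexI[of _ "\<one>\<^bsub>Q\<^esub>"]) auto
  next
    case (incl h)
    then show ?case by (rule act)
  next
    case (inv h)
    then obtain q where q: "q \<in> carrier Q" "\<And>y. y \<in> carrier H \<Longrightarrow> \<chi> (h \<otimes>\<^bsub>H\<^esub> y) = q \<otimes>\<^bsub>Q\<^esub> \<chi> y"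
      using act by blast
    have h: "h \<in> carrier H" using inv hsc by blast
    have "\<chi> (inv\<^bsub>H\<^esub> h \<otimes>\<^bsub>H\<^esub> y) = inv\<^bsub>Q\<^esub> q \<otimes>\<^bsub>Q\<^esub> \<chi> y" if y: "y \<in> carrier H" for y
    proof -
      have "\<chi> y = q \<otimes>\<^bsub>Q\<^esub> \<chi> (inv\<^bsub>H\<^esub> h \<otimes>\<^bsub>H\<^esub> y)"
        using q(2)[of "inv\<^bsub>H\<^esub> h \<otimes>\<^bsub>H\<^esub> y"] y h by (simp add: H.m_assoc[symmetric])
      then show ?thesis
        using q(1) y h \<chi>c by (simp add: Q.inv_solve_left)
    qed
    then show ?case using q(1) by blast
  next
    case (eng h1 h2)
    obtain q1 q2 where q: "q1 \<in> carrier Q" "q2 \<in> carrier Q"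
      "\<And>y. y \<in> carrier H \<Longrightarrow> \<chi> (h1 \<otimes>\<^bsub>H\<^esub> y) = q1 \<otimes>\<^bsub>Q\<^esub> \<chi> y"
      "\<And>y. y \<in> carrier H \<Longrightarrow> \<chi> (h2 \<otimes>\<^bsub>H\<^esub> y) = q2 \<otimes>\<^bsub>Q\<^esub> \<chi> y"
      using eng.IH by blast
    have h: "h1 \<in> carrier H" "h2 \<in> carrier H"
      using eng.hyps hsc(2) by auto
    show ?case
      using q h \<chi>c by (intro bexI[of _ "q1 \<otimes>\<^bsub>Q\<^esub> q2"]) (auto simp: H.m_assoc Q.m_assoc)
  qed
  then have "\<forall>z\<in>carrier H. \<exists>q. q \<in> carrier Q \<and>
      (\<forall>y\<in>carrier H. \<chi> (z \<otimes>\<^bsub>H\<^esub> y) = q \<otimes>\<^bsub>Q\<^esub> \<chi> y)"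
    using hsc(2) by blast
  then obtain \<psi> where \<psi>_all: "\<forall>z\<in>carrier H. \<psi> z \<in> carrier Q \<and>
      (\<forall>y\<in>carrier H. \<chi> (z \<otimes>\<^bsub>H\<^esub> y) = \<psi> z \<otimes>\<^bsub>Q\<^esub> \<chi> y)"
    unfolding bchoice_iff by blast
  then have \<psi>c: "\<And>z. z \<in> carrier H \<Longrightarrow> \<psi> z \<in> carrier Q"
    and \<psi>: "\<And>z y. z \<in> carrier H \<Longrightarrow> y \<in> carrier H \<Longrightarrow> \<chi> (z \<otimes>\<^bsub>H\<^esub> y) = \<psi> z \<otimes>\<^bsub>Q\<^esub> \<chi> y"
    by blast+
  \<comment> \<open>This recovers \<open>\<psi>\<close> from \<open>\<chi>\<close> up to a fixed
    right factor; cancelling that factor gives multiplicativity and surjectivity.\<close>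
  have \<chi>_one: "\<chi> z = \<psi> z \<otimes>\<^bsub>Q\<^esub> \<chi> \<one>\<^bsub>H\<^esub>" if "z \<in> carrier H" for z
    using \<psi>[OF that H.one_closed] that by simp
  have "\<psi> \<in> hom H Q"
  proof (rule homI)
    fix x y assume xy: "x \<in> carrier H" "y \<in> carrier H"
    have "\<psi> (x \<otimes>\<^bsub>H\<^esub> y) \<otimes>\<^bsub>Q\<^esub> \<chi> \<one>\<^bsub>H\<^esub> = \<psi> x \<otimes>\<^bsub>Q\<^esub> \<psi> y \<otimes>\<^bsub>Q\<^esub> \<chi> \<one>\<^bsub>H\<^esub>"
      using \<chi>_one[of "x \<otimes>\<^bsub>H\<^esub> y"] \<chi>_one[of y] \<psi>[of x y] xy \<psi>c \<chi>c by (simp add: Q.m_assoc)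
    then show "\<psi> (x \<otimes>\<^bsub>H\<^esub> y) = \<psi> x \<otimes>\<^bsub>Q\<^esub> \<psi> y"
      using xy \<psi>c \<chi>c by simp
  qed (rule \<psi>c)
  moreover have "\<psi> ` carrier H = carrier Q"
  proof
    show "carrier Q \<subseteq> \<psi> ` carrier H"
    proof
      fix q assume q: "q \<in> carrier Q"
      then obtain z where z: "z \<in> carrier H" "\<chi> z = q \<otimes>\<^bsub>Q\<^esub> \<chi> \<one>\<^bsub>H\<^esub>"
        using \<chi>_image \<chi>c by (metis H.one_closed Q.m_closed image_iff)
      then have "\<psi> z = q"
        using \<chi>_one[OF z(1)] q \<psi>c \<chi>c by simp
      then show "q \<in> \<psi> ` carrier H" using z by blast
    qed
  qed (use \<psi>c in auto)
  ultimately show ?thesis by blast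
qed

section \<open>Power maps and laws\<close>

text \<open>The power map is an endomorphism with central values. Both conjuncts are identities
  between words in two letters, the kind of statement that passes between groups through
  \<open>Con\<close>.\<close>

definition central_power :: "('a, 'b) monoid_scheme \<Rightarrow> nat \<Rightarrow> bool"
  where "central_power G k \<longleftrightarrow> (\<forall>x\<in>carrier G. \<forall>y\<in>carrier G.
    (x \<otimes>\<^bsub>G\<^esub> y) [^]\<^bsub>G\<^esub> k = x [^]\<^bsub>G\<^esub> k \<otimes>\<^bsub>G\<^esub> y [^]\<^bsub>G\<^esub> k \<and>
    x [^]\<^bsub>G\<^esub> k \<otimes>\<^bsub>G\<^esub> y = y \<otimes>\<^bsub>G\<^esub> x [^]\<^bsub>G\<^esub> k)"

definition power_set :: "('a, 'b) monoid_scheme \<Rightarrow> nat \<Rightarrow> 'a set"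
  where "power_set G k = (\<lambda>x. x [^]\<^bsub>G\<^esub> k) ` carrier G"

text \<open>The coordinates of the image of a word in the free abelian group on its letters.\<close>

fun exponent_sum :: "(nat \<times> bool) list \<Rightarrow> nat \<Rightarrow> int"
  where
    "exponent_sum [] j = 0"
  | "exponent_sum ((i, b) # w) j = (if i = j then if b then 1 else -1 else 0) + exponent_sum w j"

lemma exponent_sum_append: "exponent_sum (u @ v) j = exponent_sum u j + exponent_sum v j"
  by (induction u j rule: exponent_sum.induct) auto

lemma exponent_sum_replicate:
  "exponent_sum (replicate k (i, b)) j = (if i = j then if b then int k else - int k else 0)"
  by (induction k) auto

lemma exponent_sum_concat_replicate:
  "exponent_sum (concat (replicate k u)) j = int k * exponent_sum u j"
  by (induction k) (auto simp: exponent_sum_append algebra_simps)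

lemma word_in_replicate [simp]: "i < d \<Longrightarrow> word_in d (replicate k (i, b))"
  by (auto simp: word_in_def)

lemma word_in_concat_replicate [simp]: "word_in d u \<Longrightarrow> word_in d (concat (replicate k u))"
  by (auto simp: word_in_def)

text \<open>On \<open>W\<close> the function \<open>f\<close> factors through \<open>key\<close>, so
  its image is covered by the image of \<open>K\<close> under the factor map
  \<open>g\<close>.\<close>

lemma card_image_le_key:
  assumes "\<And>v w. v \<in> W \<Longrightarrow> w \<in> W \<Longrightarrow> key v = key w \<Longrightarrow> f v = f w"
    and "key ` W \<subseteq> K" "finite K"
  shows "finite (f ` W)" "card (f ` W) \<le> card K"
proof -
  define g where "g k = f (SOME w. w \<in> W \<and> key w = k)" for k
  have "f w = g (key w)" if "w \<in> W" for w
    unfolding g_def using someI[of "\<lambda>v. v \<in> W \<and> key v = key w" w] assms(1)[of w] that by metis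
  then have sub: "f ` W \<subseteq> g ` K"
    using assms(2) by blast
  show "finite (f ` W)"
    using sub assms(3) finite_subset by blast
  show "card (f ` W) \<le> card K"
    using sub assms(3) card_image_le[of K g] card_mono[of "g ` K" "f ` W"] by simp
qed

context group
begin

lemma word_value_concat_replicate:
  assumes "set gs \<subseteq> carrier G" "word_in (length gs) u"
  shows "word_value G gs (concat (replicate k u)) = word_value G gs u [^] k"
proof (induction k)
  case (Suc k)
  have "word_value G gs (concat (replicate (Suc k) u)) = word_value G gs u \<otimes> word_value G gs u [^] k"
    using assms Suc by (simp add: word_value_append)
  also have "\<dots> = word_value G gs u [^] Suc k"
    by (rule nat_pow_Suc2[symmetric]) (rule word_value_closed[OF assms])
  finally show ?case .
qed simp

lemma word_value_replicate:
  assumes "set gs \<subseteq> carrier G" "i < length gs"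
  shows "word_value G gs (replicate k (i, True)) = gs ! i [^] k"
proof -
  have "concat (replicate k [(i, True)]) = replicate k (i, True)"
    by (induction k) auto
  moreover have "gs ! i \<in> carrier G"
    using assms nth_mem by blast
  ultimately show ?thesis
    using word_value_concat_replicate[OF assms(1), of "[(i, True)]" k] assms(2) by simp
qed

lemma central_powerD:
  assumes "central_power G k" "x \<in> carrier G" "y \<in> carrier G"
  shows "(x \<otimes> y) [^] k = x [^] k \<otimes> y [^] k"
    and "x [^] k \<otimes> y = y \<otimes> x [^] k"
  using assms unfolding central_power_def by blast+

lemma pow_hom: "central_power G k \<Longrightarrow> (\<lambda>x. x [^] k) \<in> hom G G"
  by (intro homI central_powerD(1)) auto

text \<open>The set of powers is the image of an endomorphism, and its elements are central, so
  conjugation fixes each of them.\<close>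

lemma power_set_normal:
  assumes "central_power G k"
  shows "power_set G k \<lhd> G"
proof -
  interpret pow: group_hom G G "\<lambda>x. x [^] k"
    using pow_hom[OF assms] by unfold_locales
  have "subgroup (power_set G k) G"
    using pow.img_is_subgroup by (simp add: power_set_def)
  moreover have "x \<otimes> h \<otimes> inv x = h" if x: "x \<in> carrier G" and h: "h \<in> power_set G k" for x h
  proof -
    obtain y where y: "y \<in> carrier G" "h = y [^] k"
      using h by (auto simp: power_set_def)
    then have "x \<otimes> h = h \<otimes> x"
      using central_powerD(2)[OF assms y(1) x] by simp
    then show ?thesis
      using x y by (simp add: m_assoc)
  qed
  ultimately show ?thesis
    by (simp add: normal_inv_iff)
qed

lemma power_set_comm_group:
  assumes "central_power G k"
  shows "comm_group (G\<lparr>carrier := power_set G k\<rparr>)"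
proof -
  have "group (G\<lparr>carrier := power_set G k\<rparr>)"
    using power_set_normal[OF assms] normal_imp_subgroup subgroup.subgroup_is_group is_group by blast
  then show ?thesis
  proof (rule group.group_comm_groupI)
    fix x y assume "x \<in> carrier (G\<lparr>carrier := power_set G k\<rparr>)" "y \<in> carrier (G\<lparr>carrier := power_set G k\<rparr>)"
    then obtain u v where "u \<in> carrier G" "x = u [^] k" "v \<in> carrier G" "y = v [^] k"
      by (auto simp: power_set_def)
    then show "x \<otimes>\<^bsub>G\<lparr>carrier := power_set G k\<rparr>\<^esub> y = y \<otimes>\<^bsub>G\<lparr>carrier := power_set G k\<rparr>\<^esub> x"
      using central_powerD(2)[OF assms, of u y] by simp
  qed
qed

end

lemma hom_word_value:
  assumes "group G" "group H" "f \<in> hom G H" "set gs \<subseteq> carrier G" "word_in (length gs) w"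
  shows "f (word_value G gs w) = word_value H (map f gs) w"
proof -
  interpret group_hom G H f
    using assms by (simp add: group_hom_def group_hom_axioms_def)
  show ?thesis
    using assms(5)
  proof (induction w)
    case (Cons a w)
    then show ?case
      using G.word_value_closed[OF assms(4)] assms(4) by (cases a) (auto simp: subset_iff)
  qed simp
qed

text \<open>In a commutative group equal letters can be collected, so only exponent sums
  matter.\<close>

lemma (in comm_group) word_value_eq_finprod:
  assumes gs: "set gs \<subseteq> carrier G" and "word_in (length gs) w"
  shows "word_value G gs w = (\<Otimes>i\<in>{..<length gs}. gs ! i [^] exponent_sum w i)"
  using assms(2)
proof (induction w)
  case Nil
  have "(\<Otimes>i\<in>{..<length gs}. gs ! i [^] exponent_sum [] i) = (\<Otimes>i\<in>{..<length gs}. \<one>)"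
    by (rule finprod_cong) auto
  then show ?case by simp
next
  case (Cons a w)
  obtain i b where a: "a = (i, b)" by (cases a)
  define e :: int where "e = (if b then 1 else -1)"
  have i: "i < length gs" and w: "word_in (length gs) w"
    using Cons.prems a by auto
  have cl: "gs ! j \<in> carrier G" if "j < length gs" for j
    using gs that by auto
  have "word_value G gs (a # w) = gs ! i [^] e \<otimes> word_value G gs w"
    using cl[OF i] by (simp add: a e_def int_pow_neg)
  \<comment> \<open>The single letter is written as a product with trivial factors at all other
    indices, so that the two products merge factor by factor.\<close>
  also have "\<dots> = (\<Otimes>j\<in>{..<length gs}. if i = j then gs ! j [^] e else \<one>)
      \<otimes> (\<Otimes>j\<in>{..<length gs}. gs ! j [^] exponent_sum w j)"
    using finprod_singleton[of i "{..<length gs}" "\<lambda>j. gs ! j [^] e"] i cl Cons.IH[OF w] by (auto simp: Pi_def)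
  also have "\<dots> = (\<Otimes>j\<in>{..<length gs}. (if i = j then gs ! j [^] e else \<one>) \<otimes> gs ! j [^] exponent_sum w j)"
    using cl by (intro finprod_multf[symmetric]) auto
  also have "\<dots> = (\<Otimes>j\<in>{..<length gs}. gs ! j [^] exponent_sum (a # w) j)"
    using cl by (intro finprod_cong) (auto simp: a e_def int_pow_mult simp_implies_def)
  finally show ?case .
qed

text \<open>The constant colouring is transferred, and only the generating sequence that comes with
  it is kept.\<close>

lemma Con_generating_sequence:
  assumes "Con G \<subseteq> Con H" "group G" "group H" "generating_sequence G gs"
  obtains hs where "generating_sequence H hs"
proof -
  have "finite ((\<lambda>_. ()) ` carrier G)"
    by (rule finite_subset[of _ "{()}"]) auto
  from assms this show thesis
    by (rule Con_color_transfer) (rule that)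
qed

section \<open>Laws for powers passing from \<open>H\<close> to \<open>G\<close>\<close>

lemma (in group) commutation_word_values:
  assumes gs: "set gs \<subseteq> carrier G" and len: "1 < length gs"
  shows "word_value G gs (concat (replicate k [(0, True), (1, True)])) = (gs ! 0 \<otimes> gs ! 1) [^] k"
    and "word_value G gs (replicate k (0, True) @ replicate k (1, True)) = gs ! 0 [^] k \<otimes> gs ! 1 [^] k"
    and "word_value G gs (replicate k (0, True) @ [(1, True)]) = gs ! 0 [^] k \<otimes> gs ! 1"
    and "word_value G gs ((1, True) # replicate k (0, True)) = gs ! 1 \<otimes> gs ! 0 [^] k"
proof -
  have len0: "0 < length gs"
    using len by linarith
  then have cl: "gs ! 0 \<in> carrier G" "gs ! 1 \<in> carrier G"
    using gs len nth_mem by blast+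
  have pow: "word_value G gs (replicate k (i, True)) = gs ! i [^] k" if "i \<le> 1" for i
    using that len by (intro word_value_replicate[OF gs]) simp
  have one: "word_value G gs [(i, True)] = gs ! i" if "i \<le> 1" for i
    using that cl by (cases i) auto
  have in1: "word_in (length gs) [(0, True), (1, True)]" "word_in (length gs) [(1, True)]"
    "word_in (length gs) (replicate k (0, True))" "word_in (length gs) (replicate k (1, True))"
    using len len0 by (simp_all del: length_greater_0_conv)
  show "word_value G gs (concat (replicate k [(0, True), (1, True)])) = (gs ! 0 \<otimes> gs ! 1) [^] k"
    unfolding word_value_concat_replicate[OF gs in1(1)] using cl by simp
  show "word_value G gs (replicate k (0, True) @ replicate k (1, True)) = gs ! 0 [^] k \<otimes> gs ! 1 [^] k"
    unfolding word_value_append[OF gs in1(3,4)] by (simp add: pow)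
  show "word_value G gs (replicate k (0, True) @ [(1, True)]) = gs ! 0 [^] k \<otimes> gs ! 1"
    unfolding word_value_append[OF gs in1(3,2)] by (simp add: pow one[simplified] cl(2)[simplified])
  show "word_value G gs ((1, True) # replicate k (0, True)) = gs ! 1 \<otimes> gs ! 0 [^] k"
    by (simp add: pow)
qed

text \<open>In \<open>G\<close> the letters 0 and 1 are made to stand for the given \<open>x\<close>
  and \<open>y\<close>. In \<open>H\<close> they stand for some unknown pair, but the laws hold
  there for every pair, and equal values in \<open>H\<close> give equal values in
  \<open>G\<close>.\<close>

lemma Con_central_power:
  assumes "Con G \<subseteq> Con H" "group G" "group H" "generating_sequence G gs"
    and "central_power H k"
  shows "central_power G k"
  unfolding central_power_def
proof (intro ballI)
  interpret G: group G by fact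
  interpret H: group H by fact
  fix x y assume xy: "x \<in> carrier G" "y \<in> carrier G"
  \<comment> \<open>Enlarging a generating sequence keeps it generating, so arbitrary elements may
    be put in front.\<close>
  define gs' where "gs' = x # y # gs"
  have gs': "set gs' \<subseteq> carrier G"
    using assms(4) xy by (auto simp: generating_sequence_def gs'_def)
  moreover have "generate G (set gs) \<subseteq> generate G (set gs')"
    by (rule G.mono_generate) (auto simp: gs'_def)
  ultimately have gen: "generating_sequence G gs'"
    using assms(4) G.generate_incl[OF gs'] by (auto simp: generating_sequence_def)
  define w1 where "w1 = concat (replicate k [(0::nat, True), (1, True)])"
  define w2 where "w2 = replicate k (0::nat, True) @ replicate k (1, True)"
  define w3 where "w3 = replicate k (0::nat, True) @ [(1, True)]"
  define w4 where "w4 = (1, True) # replicate k (0::nat, True)"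
  note w_defs = w1_def w2_def w3_def w4_def
  define W where "W = {w1, w2, w3, w4}"
  have wW: "w1 \<in> W" "w2 \<in> W" "w3 \<in> W" "w4 \<in> W"
    by (simp_all add: W_def)
  have "finite W"
    by (simp add: W_def)
  have W: "word_in (length gs') w" if "w \<in> W" for w
    using that by (auto simp: W_def w_defs gs'_def)
  obtain hs where hs: "generating_sequence H hs" "length hs = length gs'"
    and eq: "\<And>v w. \<lbrakk>v \<in> W; w \<in> W; word_value H hs v = word_value H hs w\<rbrakk>
      \<Longrightarrow> word_value G gs' v = word_value G gs' w"
    using Con_word_transfer[OF assms(1-3) gen \<open>finite W\<close> W] by blast
  have hsc: "set hs \<subseteq> carrier H"
    using hs by (simp add: generating_sequence_def)
  have len: "1 < length gs'" "1 < length hs"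
    using hs(2) by (simp_all add: gs'_def)
  then have "0 < length hs"
    by linarith
  with len hsc have cl: "hs ! 0 \<in> carrier H" "hs ! 1 \<in> carrier H"
    using nth_mem by blast+
  note valsG = G.commutation_word_values[OF gs' len(1), of k, folded w_defs]
    and valsH = H.commutation_word_values[OF hsc len(2), of k, folded w_defs]
  have "word_value G gs' w1 = word_value G gs' w2"
    by (rule eq[OF wW(1,2)]) (simp only: valsH H.central_powerD(1)[OF assms(5) cl])
  moreover have "word_value G gs' w3 = word_value G gs' w4"
    by (rule eq[OF wW(3,4)]) (simp only: valsH H.central_powerD(2)[OF assms(5) cl])
  ultimately show "(x \<otimes>\<^bsub>G\<^esub> y) [^]\<^bsub>G\<^esub> k = x [^]\<^bsub>G\<^esub> k \<otimes>\<^bsub>G\<^esub> y [^]\<^bsub>G\<^esub> k \<and>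
    x [^]\<^bsub>G\<^esub> k \<otimes>\<^bsub>G\<^esub> y = y \<otimes>\<^bsub>G\<^esub> x [^]\<^bsub>G\<^esub> k"
    unfolding valsG by (simp add: gs'_def)
qed

text \<open>The exponent sums are reduced modulo \<open>k\<close> one letter at a time. Appending
  the \<open>k\<close>-th power of a word changes exponent sums by multiples of \<open>k\<close>,
  and the factor \<open>y [^] k\<close> absorbs the change.\<close>

lemma (in group) reduce_exponents:
  assumes "central_power G k" "0 < k" and gs: "set gs \<subseteq> carrier G" "generate G (set gs) = carrier G"
    and x: "x \<in> carrier G" and "m \<le> length gs"
  shows "\<exists>w y. word_in (length gs) w \<and> y \<in> carrier G \<and> x = word_value G gs w \<otimes> y [^] k
    \<and> (\<forall>i<m. exponent_sum w i \<in> {0..<int k})"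
  using assms(6)
proof (induction m)
  case 0
  obtain w where "word_in (length gs) w" "word_value G gs w = x"
    using generate_imp_word_value[OF gs(1)] gs(2) x by auto
  then show ?case
    using x by (intro exI[of _ w] exI[of _ \<one>]) auto
next
  case (Suc m)
  then obtain w y where w: "word_in (length gs) w" and y: "y \<in> carrier G"
    and xw: "x = word_value G gs w \<otimes> y [^] k"
    and e: "\<And>i. i < m \<Longrightarrow> exponent_sum w i \<in> {0..<int k}"
    by auto
  define q where "q = exponent_sum w m div int k"
  \<comment> \<open>\<open>u\<close> spells generator \<open>m\<close> to the power
    \<open>-q\<close>, hence the letter is positive exactly when \<open>q < 0\<close>. Its
    \<open>k\<close>-th power subtracts \<open>q * int k\<close> from the exponent sum and leaves
    the other sums alone.\<close>
  define u where "u = replicate (nat \<bar>q\<bar>) (m, q < 0)"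
  define w' where "w' = w @ concat (replicate k u)"
  define z where "z = word_value G gs u"
  have u: "word_in (length gs) u"
    using Suc.prems by (simp add: u_def)
  have z: "z \<in> carrier G"
    unfolding z_def by (rule word_value_closed[OF gs(1) u])
  have wc: "word_value G gs w \<in> carrier G"
    by (rule word_value_closed[OF gs(1) w])
  have val: "word_value G gs w' = word_value G gs w \<otimes> z [^] k"
    using word_value_append[OF gs(1) w, of "concat (replicate k u)"] u
    by (simp add: w'_def z_def word_value_concat_replicate[OF gs(1)])
  have "x = word_value G gs w' \<otimes> (inv z \<otimes> y) [^] k"
    unfolding val using xw y z wc central_powerD(1)[OF assms(1), of "inv z" y]
    by (simp add: m_assoc nat_pow_inv) (simp add: m_assoc[symmetric])
  moreover have "exponent_sum w' i \<in> {0..<int k}" if "i < Suc m" for i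
  proof (cases "i = m")
    case True
    have "exponent_sum w' m = exponent_sum w m - q * int k"
      by (simp add: w'_def u_def exponent_sum_append exponent_sum_concat_replicate exponent_sum_replicate)
    also have "\<dots> = exponent_sum w m mod int k"
      by (simp add: q_def minus_div_mult_eq_mod)
    finally show ?thesis
      using True \<open>0 < k\<close> by simp
  next
    case False
    then show ?thesis
      using e[of i] that
      by (simp add: w'_def u_def exponent_sum_append exponent_sum_concat_replicate exponent_sum_replicate)
  qed
  ultimately show ?case
    using w u y z by (intro exI[of _ w'] exI[of _ "inv z \<otimes> y"]) (auto simp: w'_def)
qed

text \<open>Every coset contains the value of a word with all exponent sums in
  \<open>{0..<int k}\<close>. In \<open>A \<times>\<times> F\<close> such a value is fixed by the
  exponent sums and the \<open>F\<close>-component, which gives a bound on the number of values that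
  transfers to \<open>G\<close>.\<close>

lemma Con_finite_mod_powers:
  assumes "Con G \<subseteq> Con (A \<times>\<times> F)" "group G" "comm_group A" "group F" "finite (carrier F)"
    and "generating_sequence G gs" "central_power G k" "0 < k"
  shows "finite (carrier (G Mod power_set G k))"
proof -
  interpret G: group G by fact
  interpret A: comm_group A by fact
  interpret F: group F by fact
  let ?H = "A \<times>\<times> F"
  have H: "group ?H"
    by (rule DirProd_group[OF A.is_group F.is_group])
  interpret H: group ?H by fact
  have fst_hom: "fst \<in> hom ?H A" and snd_hom: "snd \<in> hom ?H F"
    by (auto intro!: homI simp: mult_DirProd')
  have gs: "set gs \<subseteq> carrier G" "generate G (set gs) = carrier G"
    using assms(6) by (simp_all add: generating_sequence_def)
  define d where "d = length gs"
  define W where "W = {w. word_in d w \<and> (\<forall>i<d. exponent_sum w i \<in> {0..<int k})}"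
  \<comment> \<open>The possible pairs of exponent sums and \<open>F\<close>-component. This set
    depends neither on the finite sample of words nor on the generators found for it.\<close>
  define K where "K = ({..<d} \<rightarrow>\<^sub>E {0..<int k}) \<times> carrier F"
  have "finite K"
    using assms(5) by (auto simp: K_def intro!: finite_PiE)
  \<comment> \<open>Word transfer treats finitely many words at a time, with generators of the
    product that vary with the sample; a bound uniform over finite subsets still gives
    finiteness.\<close>
  have "card X \<le> card K" if X: "X \<subseteq> word_value G gs ` W" "finite X" for X
  proof -
    obtain V where V: "V \<subseteq> W" "finite V" "X = word_value G gs ` V"
      using finite_subset_image[OF X(2,1)] by blast
    have V_in: "word_in (length gs) w" if "w \<in> V" for w
      using V(1) that by (auto simp: W_def d_def)
    obtain hs where hs: "generating_sequence ?H hs" "length hs = length gs"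
      and eq: "\<And>v w. \<lbrakk>v \<in> V; w \<in> V; word_value ?H hs v = word_value ?H hs w\<rbrakk>
        \<Longrightarrow> word_value G gs v = word_value G gs w"
      using Con_word_transfer[OF assms(1,2) H assms(6) V(2) V_in] by blast
    have hsc: "set hs \<subseteq> carrier ?H"
      using hs by (simp add: generating_sequence_def)
    have fst_sub: "set (map fst hs) \<subseteq> carrier A"
      using hsc by auto
    define key where "key w = (restrict (exponent_sum w) {..<d}, snd (word_value ?H hs w))" for w
    have fst_val: "fst (word_value ?H hs w)
        = (\<Otimes>\<^bsub>A\<^esub>i\<in>{..<d}. fst (hs ! i) [^]\<^bsub>A\<^esub> restrict (exponent_sum w) {..<d} i)" if "w \<in> V" for w
    proof -
      have "fst (word_value ?H hs w) = word_value A (map fst hs) w"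
        using hom_word_value[OF H A.is_group fst_hom hsc, of w] V_in[OF that] hs(2) by simp
      also have "\<dots> = (\<Otimes>\<^bsub>A\<^esub>i\<in>{..<d}. map fst hs ! i [^]\<^bsub>A\<^esub> exponent_sum w i)"
        using A.word_value_eq_finprod[OF fst_sub, of w] V_in[OF that] hs(2)
        by (simp add: d_def)
      also have "\<dots> = (\<Otimes>\<^bsub>A\<^esub>i\<in>{..<d}. fst (hs ! i) [^]\<^bsub>A\<^esub> restrict (exponent_sum w) {..<d} i)"
      proof (rule A.finprod_cong')
        have "fst (hs ! i) \<in> carrier A" if "i < d" for i
          using fst_sub nth_mem[of i "map fst hs"] that hs(2) by (auto simp: d_def)
        then show "(\<lambda>i. fst (hs ! i) [^]\<^bsub>A\<^esub> restrict (exponent_sum w) {..<d} i) \<in> {..<d} \<rightarrow> carrier A"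
          by simp
      qed (simp_all add: hs(2) d_def)
      finally show ?thesis .
    qed
    have "word_value G gs v = word_value G gs w" if "v \<in> V" "w \<in> V" "key v = key w" for v w
    proof (rule eq[OF that(1,2)], rule prod_eqI)
      show "fst (word_value ?H hs v) = fst (word_value ?H hs w)"
        unfolding fst_val[OF that(1)] fst_val[OF that(2)] using that(3) by (simp only: key_def prod.inject)
    qed (use that(3) in \<open>simp add: key_def\<close>)
    moreover have "key ` V \<subseteq> K"
    proof
      fix k' assume "k' \<in> key ` V"
      then obtain w where w: "w \<in> V" "k' = key w"
        by blast
      have "word_value ?H hs w \<in> carrier ?H"
        using H.word_value_closed[OF hsc] V_in[OF w(1)] hs(2) by simp
      moreover have "restrict (exponent_sum w) {..<d} \<in> {..<d} \<rightarrow>\<^sub>E {0..<int k}"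
        using w(1) V(1) by (auto simp: W_def)
      ultimately show "k' \<in> K"
        by (simp add: w(2) key_def K_def mem_Times_iff)
    qed
    ultimately show ?thesis
      unfolding V(3) using \<open>finite K\<close> by (rule card_image_le_key)
  qed
  then have fin: "finite (word_value G gs ` W)"
    by (rule conjunct1[OF finite_if_finite_subsets_card_bdd])
  have N: "power_set G k \<lhd> G"
    by (rule G.power_set_normal) fact
  have "carrier (G Mod power_set G k) \<subseteq> (\<lambda>x. power_set G k #>\<^bsub>G\<^esub> x) ` word_value G gs ` W"
  proof
    fix C assume "C \<in> carrier (G Mod power_set G k)"
    then obtain x where x: "x \<in> carrier G" "C = power_set G k #>\<^bsub>G\<^esub> x"
      by (auto simp: FactGroup_def RCOSETS_def)
    obtain w y where w: "word_in d w" "y \<in> carrier G" "x = word_value G gs w \<otimes>\<^bsub>G\<^esub> y [^]\<^bsub>G\<^esub> k"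
      "\<forall>i<d. exponent_sum w i \<in> {0..<int k}"
      using G.reduce_exponents[OF assms(7,8) gs x(1) order_refl] by (auto simp: d_def)
    have wc: "word_value G gs w \<in> carrier G"
      using w(1) G.word_value_closed[OF gs(1)] by (simp add: d_def)
    have "x = y [^]\<^bsub>G\<^esub> k \<otimes>\<^bsub>G\<^esub> word_value G gs w"
      using w(3) G.central_powerD(2)[OF assms(7) w(2) wc] by simp
    then have "x \<in> power_set G k #>\<^bsub>G\<^esub> word_value G gs w"
      using w(2) by (auto simp: r_coset_def power_set_def)
    then have "C = power_set G k #>\<^bsub>G\<^esub> word_value G gs w"
      using x(2) G.repr_independence[OF _ wc normal_imp_subgroup[OF N]] by simp
    then show "C \<in> (\<lambda>x. power_set G k #>\<^bsub>G\<^esub> x) ` word_value G gs ` W"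
      using w by (auto simp: W_def)
  qed
  then show ?thesis
    using fin finite_subset by blast
qed

section \<open>Homomorphic images of integer vectors\<close>

abbreviation int_vectors :: "'i set \<Rightarrow> ('i \<Rightarrow> int) monoid"
  where "int_vectors I \<equiv> product_group I (\<lambda>_. integer_group)"

lemma nat_pow_product_group:
  assumes "\<And>i. i \<in> I \<Longrightarrow> group (G i)" "x \<in> carrier (product_group I G)"
  shows "x [^]\<^bsub>product_group I G\<^esub> (m::nat) = (\<lambda>i\<in>I. x i [^]\<^bsub>G i\<^esub> m)"
proof (induction m)
  case (Suc m)
  then show ?case
    using assms by (auto simp: restrict_def nat_pow_Suc)
qed (simp add: restrict_def)

lemma nat_pow_DirProd: "(x, y) [^]\<^bsub>G \<times>\<times> H\<^esub> (m::nat) = (x [^]\<^bsub>G\<^esub> m, y [^]\<^bsub>H\<^esub> m)"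
  by (induction m) (auto simp: nat_pow_Suc)

lemma int_pow_int_vectors:
  assumes "x \<in> carrier (int_vectors I)"
  shows "x [^]\<^bsub>int_vectors I\<^esub> (z::int) = (\<lambda>i\<in>I. z * x i)"
proof -
  interpret group "int_vectors I" by simp
  have nat: "x [^]\<^bsub>int_vectors I\<^esub> m = (\<lambda>i\<in>I. int m * x i)" for m
    using nat_pow_product_group[of I "\<lambda>_. integer_group" x m] assms by simp
  show ?thesis
  proof (cases "z < 0")
    case True
    have "inv\<^bsub>int_vectors I\<^esub> (\<lambda>i\<in>I. int (nat (- z)) * x i) = (\<lambda>i\<in>I. z * x i)"
      using True by (subst inv_product_group) auto
    then show ?thesis
      using True by (simp only: int_pow_def2 nat if_True)
  next
    case False
    then show ?thesis
      by (simp add: int_pow_def2 nat)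
  qed
qed

lemma (in group) int_pow_eq_one_imp_nat:
  assumes "x \<in> carrier G" "x [^] (z::int) = \<one>"
  shows "x [^] nat \<bar>z\<bar> = \<one>"
proof (cases "z < 0")
  case True
  then have "inv (x [^] nat (- z)) = \<one>"
    using assms(2) by (simp only: int_pow_def2 if_True)
  then have "x [^] nat (- z) = \<one>"
    using assms(1) by (metis inv_one inv_inv nat_pow_closed)
  then show ?thesis
    using True by simp
next
  case False
  then have "x [^] nat z = \<one>"
    using assms(2) by (simp only: int_pow_def2 if_False)
  then show ?thesis
    using False by simp
qed

lemma int_vectors_nonzero_coordinate:
  assumes "c \<in> carrier (int_vectors I)" "c \<noteq> \<one>\<^bsub>int_vectors I\<^esub>"
  obtains i where "i \<in> I" "c i \<noteq> 0"
proof -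
  have "c = \<one>\<^bsub>int_vectors I\<^esub>" if "\<forall>i\<in>I. c i = 0"
    using that assms(1) by (auto simp: PiE_iff extensional_def fun_eq_iff)
  with assms(2) that show thesis
    by blast
qed

text \<open>The update \<open>v(i := 0)\<close> embeds the vectors without coordinate
  \<open>i\<close>; the value must be set because extensional functions are \<open>undefined\<close>
  outside their index set.\<close>

lemma hom_drop_coordinate:
  assumes "\<theta> \<in> hom (int_vectors I) A" "i \<in> I"
  shows "(\<lambda>v. \<theta> (v(i := 0))) \<in> hom (int_vectors (I - {i})) A"
proof (rule homI)
  have ext: "v(i := 0) \<in> carrier (int_vectors I)" if "v \<in> carrier (int_vectors (I - {i}))" for v
    using that assms(2) by (auto simp: PiE_iff extensional_def)
  fix x y assume x: "x \<in> carrier (int_vectors (I - {i}))" and y: "y \<in> carrier (int_vectors (I - {i}))"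
  show "\<theta> (x(i := 0)) \<in> carrier A"
    using hom_in_carrier[OF assms(1) ext[OF x]] .
  have "(x \<otimes>\<^bsub>int_vectors (I - {i})\<^esub> y)(i := 0) = x(i := 0) \<otimes>\<^bsub>int_vectors I\<^esub> y(i := 0)"
    using assms(2) by (auto simp: fun_eq_iff)
  then show "\<theta> ((x \<otimes>\<^bsub>int_vectors (I - {i})\<^esub> y)(i := 0)) = \<theta> (x(i := 0)) \<otimes>\<^bsub>A\<^esub> \<theta> (y(i := 0))"
    using hom_mult[OF assms(1) ext[OF x] ext[OF y]] by simp
qed

text \<open>Induction on the number of coordinates. If \<open>\<theta>\<close> is injective, its
  image is torsion free and \<open>e = 1\<close> works. Otherwise a relation \<open>c\<close> with
  \<open>c i \<noteq> 0\<close> expresses \<open>\<theta> v\<close> to the power \<open>c i\<close>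
  without coordinate \<open>i\<close>, which multiplies the exponent by the absolute value of
  \<open>c i\<close>.\<close>

lemma bounded_torsion_image_int_vectors:
  assumes "finite I" "group A" "\<theta> \<in> hom (int_vectors I) A"
  shows "\<exists>e>0. \<forall>v\<in>carrier (int_vectors I). \<forall>m>0.
    \<theta> v [^]\<^bsub>A\<^esub> (m::nat) = \<one>\<^bsub>A\<^esub> \<longrightarrow> \<theta> v [^]\<^bsub>A\<^esub> (e::nat) = \<one>\<^bsub>A\<^esub>"
  using assms(1,3)
proof (induction "card I" arbitrary: I \<theta> rule: less_induct)
  case less
  interpret A: group A by fact
  interpret \<theta>: group_hom "int_vectors I" A \<theta>
    using less.prems by (simp add: group_hom_def group_hom_axioms_def assms(2))
  show ?case
  proof (cases "\<forall>v\<in>carrier (int_vectors I). \<theta> v = \<one>\<^bsub>A\<^esub> \<longrightarrow> v = \<one>\<^bsub>int_vectors I\<^esub>")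
    case True
    have "\<theta> v = \<one>\<^bsub>A\<^esub>" if v: "v \<in> carrier (int_vectors I)" and m: "0 < m" "\<theta> v [^]\<^bsub>A\<^esub> (m::nat) = \<one>\<^bsub>A\<^esub>" for v m
    proof -
      have "\<theta> (v [^]\<^bsub>int_vectors I\<^esub> int m) = \<one>\<^bsub>A\<^esub>"
        using m(2) v by (simp add: \<theta>.hom_nat_pow int_pow_int)
      then have "(\<lambda>i\<in>I. int m * v i) = \<one>\<^bsub>int_vectors I\<^esub>"
        using True v \<theta>.int_pow_closed[OF v, of "int m"] by (simp only: int_pow_int_vectors[OF v])
      then have "int m * v i = 0" if "i \<in> I" for i
        using that by (auto simp: fun_eq_iff split: if_splits)
      then have "v = \<one>\<^bsub>int_vectors I\<^esub>"
        using v m(1) by (auto simp: PiE_iff extensional_def fun_eq_iff)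
      then show ?thesis
        by (simp only: \<theta>.hom_one)
    qed
    then have "\<theta> v [^]\<^bsub>A\<^esub> (1::nat) = \<one>\<^bsub>A\<^esub>"
      if "v \<in> carrier (int_vectors I)" "0 < m" "\<theta> v [^]\<^bsub>A\<^esub> (m::nat) = \<one>\<^bsub>A\<^esub>" for v m
      using that by simp
    then show ?thesis
      using zero_less_one by blast
  next
    case False
    then obtain c where c: "c \<in> carrier (int_vectors I)" "\<theta> c = \<one>\<^bsub>A\<^esub>" "c \<noteq> \<one>\<^bsub>int_vectors I\<^esub>"
      by blast
    obtain i where i: "i \<in> I" "c i \<noteq> 0"
      using c(1,3) by (rule int_vectors_nonzero_coordinate)
    have "card (I - {i}) < card I"
      using i less.prems(1) by (intro psubset_card_mono) auto
    then obtain e where e: "0 < e" "\<And>v m. \<lbrakk>v \<in> carrier (int_vectors (I - {i})); 0 < (m::nat);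
      \<theta> (v(i := 0)) [^]\<^bsub>A\<^esub> m = \<one>\<^bsub>A\<^esub>\<rbrakk> \<Longrightarrow> \<theta> (v(i := 0)) [^]\<^bsub>A\<^esub> (e::nat) = \<one>\<^bsub>A\<^esub>"
      using less.hyps[of "I - {i}", OF _ _ hom_drop_coordinate[OF less.prems(2) i(1)]] less.prems(1)
      by auto
    have "\<theta> v [^]\<^bsub>A\<^esub> (nat \<bar>c i\<bar> * e) = \<one>\<^bsub>A\<^esub>"
      if v: "v \<in> carrier (int_vectors I)" and m: "0 < m" "\<theta> v [^]\<^bsub>A\<^esub> (m::nat) = \<one>\<^bsub>A\<^esub>" for v m
    proof -
      \<comment> \<open>The combination cancels coordinate \<open>i\<close>, and its image is
        \<open>\<theta> v\<close> to the power \<open>c i\<close> because \<open>\<theta>\<close>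
        kills \<open>c\<close>.\<close>
      define u where "u = v [^]\<^bsub>int_vectors I\<^esub> c i \<otimes>\<^bsub>int_vectors I\<^esub> c [^]\<^bsub>int_vectors I\<^esub> (- v i)"
      define u' where "u' = restrict u (I - {i})"
      have "u = (\<lambda>j\<in>I. c i * v j - v i * c j)"
        unfolding u_def int_pow_int_vectors[OF v] int_pow_int_vectors[OF c(1)] by auto
      then have u: "u = u'(i := 0)" "u' \<in> carrier (int_vectors (I - {i}))"
        using i by (auto simp: u'_def fun_eq_iff)
      have \<theta>v: "\<theta> v \<in> carrier A"
        using v by (rule \<theta>.hom_closed)
      have \<theta>u: "\<theta> u = \<theta> v [^]\<^bsub>A\<^esub> c i"
        using \<theta>v c(2) by (simp add: u_def v c(1) \<theta>.hom_int_pow del: carrier_product_group mult_product_group)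
      have "\<theta> u [^]\<^bsub>A\<^esub> m = (\<theta> v [^]\<^bsub>A\<^esub> m) [^]\<^bsub>A\<^esub> c i"
        unfolding \<theta>u int_pow_int[symmetric] by (simp only: A.int_pow_pow[OF \<theta>v] mult.commute)
      then have "\<theta> u [^]\<^bsub>A\<^esub> m = \<one>\<^bsub>A\<^esub>"
        using m(2) by simp
      then have "\<theta> u [^]\<^bsub>A\<^esub> e = \<one>\<^bsub>A\<^esub>"
        using e(2)[OF u(2) m(1)] u(1) by simp
      then have "\<theta> v [^]\<^bsub>A\<^esub> (c i * int e) = \<one>\<^bsub>A\<^esub>"
        unfolding \<theta>u int_pow_int[symmetric] by (simp only: A.int_pow_pow[OF \<theta>v])
      then have "\<theta> v [^]\<^bsub>A\<^esub> nat \<bar>c i * int e\<bar> = \<one>\<^bsub>A\<^esub>"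
        by (rule A.int_pow_eq_one_imp_nat[OF \<theta>v])
      moreover have "nat \<bar>c i * int e\<bar> = nat \<bar>c i\<bar> * e"
        by (simp add: abs_mult nat_mult_distrib)
      ultimately show ?thesis
        by simp
    qed
    moreover have "0 < nat \<bar>c i\<bar> * e"
      using i e(1) by simp
    ultimately show ?thesis
      by blast
  qed
qed

text \<open>Euclid's algorithm on the coefficients of the relation \<open>c\<close>: precomposing \<open>\<theta>\<close> with a shear of
  \<open>\<int>\<^sup>I\<close> shortens \<open>c\<close> until a single coefficient is left, and then torsion-freeness kills that generator.\<close>

lemma drop_generator:
  assumes "finite I" "group A"
    and torsion_free: "\<forall>a\<in>carrier A. \<forall>m>0. a [^]\<^bsub>A\<^esub> (m::nat) = \<one>\<^bsub>A\<^esub> \<longrightarrow> a = \<one>\<^bsub>A\<^esub>"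
    and "\<theta> \<in> hom (int_vectors I) A" "\<theta> ` carrier (int_vectors I) = carrier A"
    and "c \<in> carrier (int_vectors I)" "\<theta> c = \<one>\<^bsub>A\<^esub>" "c \<noteq> \<one>\<^bsub>int_vectors I\<^esub>"
  shows "\<exists>i\<in>I. \<exists>\<theta>'\<in>hom (int_vectors (I - {i})) A. \<theta>' ` carrier (int_vectors (I - {i})) = carrier A"
  using assms(4-8)
proof (induction "\<Sum>i\<in>I. nat \<bar>c i\<bar>" arbitrary: c \<theta> rule: less_induct)
  case less
  interpret A: group A by fact
  interpret \<theta>: group_hom "int_vectors I" A \<theta>
    using less.prems by (simp add: group_hom_def group_hom_axioms_def assms(2))
  obtain i0 where i0: "i0 \<in> I" "c i0 \<noteq> 0"
    using less.prems(3,5) by (rule int_vectors_nonzero_coordinate)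
  show ?case
  proof (cases "\<exists>j\<in>I. j \<noteq> i0 \<and> c j \<noteq> 0")
    case True
    then obtain j0 where "j0 \<in> I" "j0 \<noteq> i0" "c j0 \<noteq> 0"
      by blast
    then obtain i j where ij: "i \<in> I" "j \<in> I" "i \<noteq> j" "c j \<noteq> 0" "\<bar>c j\<bar> \<le> \<bar>c i\<bar>"
      using i0 by (metis linear)
    \<comment> \<open>With this sign \<open>s * c j\<close> has the sign of \<open>c i\<close>, and
      \<open>c j\<close> is nonzero and no larger in absolute value, so the subtraction strictly
      shrinks coordinate \<open>i\<close>. The shear \<open>\<sigma>\<close> sends \<open>c'\<close>
      back to \<open>c\<close>, which makes \<open>c'\<close> a relation for
      \<open>\<theta> \<circ> \<sigma>\<close>.\<close>
    define s where "s = sgn (c i) * sgn (c j)"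
    define c' where "c' = c(i := c i - s * c j)"
    define \<sigma> where "\<sigma> w = w(i := w i + s * w j)" for w :: "_ \<Rightarrow> int"
    have \<sigma>c: "\<sigma> w \<in> carrier (int_vectors I)" if "w \<in> carrier (int_vectors I)" for w
      using that ij(1) by (auto simp: \<sigma>_def PiE_iff extensional_def)
    have "\<sigma> (x \<otimes>\<^bsub>int_vectors I\<^esub> y) = \<sigma> x \<otimes>\<^bsub>int_vectors I\<^esub> \<sigma> y" for x y
      using ij(1,2) by (auto simp: \<sigma>_def fun_eq_iff algebra_simps)
    then have "\<sigma> \<in> hom (int_vectors I) (int_vectors I)"
      using \<sigma>c by (intro homI)
    then have hom: "\<theta> \<circ> \<sigma> \<in> hom (int_vectors I) A"
      using less.prems(1) by (rule hom_compose)
    have "\<sigma> ` carrier (int_vectors I) = carrier (int_vectors I)"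
    proof (intro equalityI subsetI)
      fix w assume w: "w \<in> carrier (int_vectors I)"
      have "w = \<sigma> (w(i := w i - s * w j))"
        using ij(3) by (auto simp: \<sigma>_def)
      moreover have "w(i := w i - s * w j) \<in> carrier (int_vectors I)"
        using w ij(1) by (auto simp: PiE_iff extensional_def)
      ultimately show "w \<in> \<sigma> ` carrier (int_vectors I)"
        by (rule image_eqI)
    qed (use \<sigma>c in blast)
    then have onto: "(\<theta> \<circ> \<sigma>) ` carrier (int_vectors I) = carrier A"
      using less.prems(2) by (simp only: image_comp[symmetric])
    have c': "c' \<in> carrier (int_vectors I)"
      using less.prems(3) ij(1) by (auto simp: c'_def PiE_iff extensional_def)
    have "\<sigma> c' = c"
      using ij(3) by (auto simp: \<sigma>_def c'_def)
    then have ker: "(\<theta> \<circ> \<sigma>) c' = \<one>\<^bsub>A\<^esub>"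
      using less.prems(4) by simp
    have "c' j \<noteq> 0"
      using ij by (simp add: c'_def)
    then have nz: "c' \<noteq> \<one>\<^bsub>int_vectors I\<^esub>"
      using ij(2) by auto
    have "\<bar>c i - s * c j\<bar> < \<bar>c i\<bar>"
      using ij(4,5) by (auto simp: s_def sgn_if)
    then have "(\<Sum>k\<in>I. nat \<bar>c' k\<bar>) < (\<Sum>k\<in>I. nat \<bar>c k\<bar>)"
      using ij(1) assms(1) by (intro sum_strict_mono_ex1) (auto simp: c'_def)
    from less.hyps[OF this hom onto c' ker nz] show ?thesis .
  next
    case False
    define e where "e = (\<lambda>j\<in>I. if j = i0 then 1 else 0 :: int)"
    have e: "e \<in> carrier (int_vectors I)"
      by (simp add: e_def)
    have "c = e [^]\<^bsub>int_vectors I\<^esub> c i0"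
      unfolding int_pow_int_vectors[OF e] using False less.prems(3)
      by (auto simp: e_def fun_eq_iff PiE_iff extensional_def)
    then have "\<theta> e [^]\<^bsub>A\<^esub> c i0 = \<one>\<^bsub>A\<^esub>"
      using less.prems(4) \<theta>.hom_int_pow[OF e, of "c i0"] by simp
    then have "\<theta> e = \<one>\<^bsub>A\<^esub>"
      using torsion_free A.int_pow_eq_one_imp_nat[of "\<theta> e" "c i0"] \<theta>.hom_closed[OF e] i0(2)
      by (metis zero_less_abs_iff zero_less_nat_eq)
    \<comment> \<open>Since \<open>\<theta>\<close> kills the unit vector \<open>e\<close>,
      coordinate \<open>i0\<close> can be cleared without changing the image.\<close>
    have "\<exists>w\<in>carrier (int_vectors (I - {i0})). \<theta> v = \<theta> (w(i0 := 0))"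
      if v: "v \<in> carrier (int_vectors I)" for v
    proof
      define w where "w = restrict v (I - {i0})"
      show "w \<in> carrier (int_vectors (I - {i0}))"
        by (simp add: w_def)
      have w: "w(i0 := 0) \<in> carrier (int_vectors I)"
        using i0(1) by (auto simp: w_def)
      have "v = w(i0 := 0) \<otimes>\<^bsub>int_vectors I\<^esub> e [^]\<^bsub>int_vectors I\<^esub> v i0"
        unfolding int_pow_int_vectors[OF e] using v i0(1)
        by (auto simp: e_def w_def fun_eq_iff PiE_iff extensional_def)
      then have "\<theta> v = \<theta> (w(i0 := 0)) \<otimes>\<^bsub>A\<^esub> \<theta> (e [^]\<^bsub>int_vectors I\<^esub> v i0)"
        using \<theta>.hom_mult[OF w \<theta>.int_pow_closed[OF e, of "v i0"]] by simp
      also have "\<dots> = \<theta> (w(i0 := 0))"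
        using \<theta>.hom_int_pow[OF e, of "v i0"] \<open>\<theta> e = \<one>\<^bsub>A\<^esub>\<close> \<theta>.hom_closed[OF w] by simp
      finally show "\<theta> v = \<theta> (w(i0 := 0))" .
    qed
    then have "carrier A \<subseteq> (\<lambda>w. \<theta> (w(i0 := 0))) ` carrier (int_vectors (I - {i0}))"
      unfolding less.prems(2)[symmetric] by blast
    moreover have hom: "(\<lambda>w. \<theta> (w(i0 := 0))) \<in> hom (int_vectors (I - {i0})) A"
      using hom_drop_coordinate[OF less.prems(1) i0(1)] .
    ultimately have "(\<lambda>w. \<theta> (w(i0 := 0))) ` carrier (int_vectors (I - {i0})) = carrier A"
      using hom_carrier[OF hom] by blast
    with hom i0(1) show ?thesis
      by blast
  qed
qed

lemma torsion_free_imp_iso_int_vectors: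
  assumes "finite I" "group A"
    and torsion_free: "\<forall>a\<in>carrier A. \<forall>m>0. a [^]\<^bsub>A\<^esub> (m::nat) = \<one>\<^bsub>A\<^esub> \<longrightarrow> a = \<one>\<^bsub>A\<^esub>"
    and "\<theta> \<in> hom (int_vectors I) A" "\<theta> ` carrier (int_vectors I) = carrier A"
  shows "\<exists>J\<subseteq>I. int_vectors J \<cong> A"
  using assms(1,4,5)
proof (induction "card I" arbitrary: I \<theta> rule: less_induct)
  case less
  interpret \<theta>: group_hom "int_vectors I" A \<theta>
    using less.prems by (simp add: group_hom_def group_hom_axioms_def assms(2))
  show ?case
  proof (cases "\<exists>c\<in>carrier (int_vectors I). \<theta> c = \<one>\<^bsub>A\<^esub> \<and> c \<noteq> \<one>\<^bsub>int_vectors I\<^esub>")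
    case True
    then obtain i \<theta>' where i: "i \<in> I" and \<theta>': "\<theta>' \<in> hom (int_vectors (I - {i})) A"
      "\<theta>' ` carrier (int_vectors (I - {i})) = carrier A"
      using drop_generator[OF less.prems(1) assms(2) torsion_free less.prems(2,3)] by blast
    have "card (I - {i}) < card I"
      using i less.prems(1) by (intro psubset_card_mono) auto
    from less.hyps[OF this _ \<theta>'] less.prems(1) obtain J where "J \<subseteq> I - {i}" "int_vectors J \<cong> A"
      by auto
    then show ?thesis
      by blast
  next
    case False
    then have "\<theta> \<in> iso (int_vectors I) A"
      using less.prems(2,3) \<theta>.inj_on_one_iff by (auto simp: iso_def bij_betw_def simp del: carrier_product_group one_product_group)
    then show ?thesis
      by (auto simp: is_iso_def)
  qed
qed

section \<open>Finite quotients by powers\<close>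

text \<open>The power map sends a word in the generators to the same word in their
  \<open>k\<close>-th powers. These lie in a commutative group, so the exponent vector of the word
  determines the result.\<close>

lemma power_set_image_int_vectors:
  assumes "group G" "generating_sequence G gs" "central_power G k"
  shows "\<exists>\<theta>\<in>hom (int_vectors {..<length gs}) (G\<lparr>carrier := power_set G k\<rparr>).
    \<theta> ` carrier (int_vectors {..<length gs}) = power_set G k"
proof -
  interpret G: group G by fact
  define A where "A = G\<lparr>carrier := power_set G k\<rparr>"
  interpret A: comm_group A
    unfolding A_def by (rule G.power_set_comm_group) fact
  have carrierA: "carrier A = power_set G k"
    by (simp add: A_def)
  let ?d = "length gs"
  have gs: "set gs \<subseteq> carrier G" "generate G (set gs) = carrier G"
    using assms(2) by (simp_all add: generating_sequence_def)
  have pow_hom: "(\<lambda>x. x [^]\<^bsub>G\<^esub> k) \<in> hom G A"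
    using G.central_powerD(1)[OF assms(3)] by (intro homI) (auto simp: A_def power_set_def)
  define as where "as = map (\<lambda>x. x [^]\<^bsub>G\<^esub> k) gs"
  have as: "set as \<subseteq> carrier A" and len: "length as = ?d"
    using hom_in_carrier[OF pow_hom] gs(1) by (auto simp: as_def)
  have a: "as ! i \<in> carrier A" if "i < ?d" for i
    using as nth_mem[of i as] that len by auto
  define \<theta> where "\<theta> v = (\<Otimes>\<^bsub>A\<^esub>i\<in>{..<?d}. as ! i [^]\<^bsub>A\<^esub> (v i :: int))" for v
  have \<theta>_closed: "\<theta> v \<in> carrier A" for v
    unfolding \<theta>_def using a by (intro A.finprod_closed) auto
  have hom: "\<theta> \<in> hom (int_vectors {..<?d}) A"
  proof (rule homI)
    fix x y :: "nat \<Rightarrow> int"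
    have "\<theta> (x \<otimes>\<^bsub>int_vectors {..<?d}\<^esub> y)
        = (\<Otimes>\<^bsub>A\<^esub>i\<in>{..<?d}. as ! i [^]\<^bsub>A\<^esub> x i \<otimes>\<^bsub>A\<^esub> as ! i [^]\<^bsub>A\<^esub> y i)"
      unfolding \<theta>_def using a by (intro A.finprod_cong') (auto simp: A.int_pow_mult)
    also have "\<dots> = \<theta> x \<otimes>\<^bsub>A\<^esub> \<theta> y"
      unfolding \<theta>_def using a by (intro A.finprod_multf) auto
    finally show "\<theta> (x \<otimes>\<^bsub>int_vectors {..<?d}\<^esub> y) = \<theta> x \<otimes>\<^bsub>A\<^esub> \<theta> y" .
  qed (rule \<theta>_closed)
  have "\<exists>v\<in>carrier (int_vectors {..<?d}). a = \<theta> v" if a_in: "a \<in> carrier A" for a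
  proof -
    obtain x where x: "x \<in> carrier G" "a = x [^]\<^bsub>G\<^esub> k"
      using a_in by (auto simp: carrierA power_set_def)
    obtain w where w: "word_in ?d w" "word_value G gs w = x"
      using G.generate_imp_word_value[OF gs(1)] gs(2) x(1) by auto
    have "a = word_value A as w"
      using hom_word_value[OF assms(1) A.is_group pow_hom gs(1) w(1)] w(2) x(2) by (simp add: as_def)
    also have "\<dots> = (\<Otimes>\<^bsub>A\<^esub>i\<in>{..<?d}. as ! i [^]\<^bsub>A\<^esub> exponent_sum w i)"
      using A.word_value_eq_finprod[OF as] w(1) len by simp
    also have "\<dots> = \<theta> (restrict (exponent_sum w) {..<?d})"
      unfolding \<theta>_def using a by (intro A.finprod_cong') auto
    finally show ?thesis
      by (intro bexI[of _ "restrict (exponent_sum w) {..<?d}"]) auto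
  qed
  then have "\<theta> ` carrier (int_vectors {..<?d}) = carrier A"
    using \<theta>_closed by blast
  with hom show ?thesis
    by (intro bexI[of _ \<theta>]) (simp_all add: A_def)
qed

section \<open>Integer vectors modulo \<open>K\<close> with a finite factor\<close>

abbreviation int_mod_vectors :: "nat \<Rightarrow> 'i set \<Rightarrow> ('i \<Rightarrow> int) monoid"
  where "int_mod_vectors K I \<equiv> product_group I (\<lambda>_. integer_mod_group K)"

definition reduce_mod :: "nat \<Rightarrow> 'i set \<Rightarrow> ('i \<Rightarrow> int) \<times> 'f \<Rightarrow> ('i \<Rightarrow> int) \<times> 'f"
  where "reduce_mod K I x = (\<lambda>i\<in>I. fst x i mod int K, snd x)"

lemma (in group) pow_eq_one_of_card_dvd:
  assumes "finite (carrier G)" "card (carrier G) dvd k" "x \<in> carrier G"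
  shows "x [^] k = \<one>"
proof -
  obtain m where "k = order G * m"
    using assms(2) by (auto simp: order_def)
  then have "x [^] k = (x [^] order G) [^] m"
    using assms(3) by (simp add: nat_pow_pow)
  then show ?thesis
    using pow_order_eq_1[OF assms(3)] by simp
qed

context
  fixes F :: "('f, 'p) monoid_scheme" and I :: "'i set" and K :: nat
  assumes F: "group F" "finite (carrier F)" and K: "0 < K" "card (carrier F) dvd K"
begin

interpretation F: group F by (rule F)

lemma int_vectors_DirProd_pow:
  assumes "v \<in> carrier (int_vectors I)" "f \<in> carrier F"
  shows "(v, f) [^]\<^bsub>int_vectors I \<times>\<times> F\<^esub> K = (\<lambda>i\<in>I. int K * v i, \<one>\<^bsub>F\<^esub>)"
  using nat_pow_product_group[of I "\<lambda>_. integer_group" v K] assms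
    F.pow_eq_one_of_card_dvd[OF F(2) K(2)] by (simp add: nat_pow_DirProd)

text \<open>The order of \<open>F\<close> divides \<open>K\<close>, so a \<open>K\<close>-th power
  has trivial \<open>F\<close>-component; what remains is additive in the vector and commutes with
  everything.\<close>

lemma central_power_int_vectors: "central_power (int_vectors I \<times>\<times> F) K"
proof -
  interpret H: group "int_vectors I \<times>\<times> F"
    by (intro DirProd_group F) simp
  show ?thesis
    unfolding central_power_def
  proof (intro ballI conjI)
    fix x y assume "x \<in> carrier (int_vectors I \<times>\<times> F)" "y \<in> carrier (int_vectors I \<times>\<times> F)"
    moreover obtain v f w g where xy: "x = (v, f)" "y = (w, g)"
      by (cases x; cases y)
    ultimately have cl: "v \<in> carrier (int_vectors I)" "f \<in> carrier F" "w \<in> carrier (int_vectors I)" "g \<in> carrier F"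
      by simp_all
    have vw: "(\<lambda>i\<in>I. v i + w i) \<in> carrier (int_vectors I)"
      by simp
    have m: "x \<otimes>\<^bsub>int_vectors I \<times>\<times> F\<^esub> y = (\<lambda>i\<in>I. v i + w i, f \<otimes>\<^bsub>F\<^esub> g)"
      by (simp add: xy)
    show "(x \<otimes>\<^bsub>int_vectors I \<times>\<times> F\<^esub> y) [^]\<^bsub>int_vectors I \<times>\<times> F\<^esub> K =
        x [^]\<^bsub>int_vectors I \<times>\<times> F\<^esub> K \<otimes>\<^bsub>int_vectors I \<times>\<times> F\<^esub> y [^]\<^bsub>int_vectors I \<times>\<times> F\<^esub> K"
      unfolding m unfolding int_vectors_DirProd_pow[OF vw F.m_closed[OF cl(2,4)]] xy
        int_vectors_DirProd_pow[OF cl(1,2)] int_vectors_DirProd_pow[OF cl(3,4)]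
      by (auto simp: algebra_simps)
    show "x [^]\<^bsub>int_vectors I \<times>\<times> F\<^esub> K \<otimes>\<^bsub>int_vectors I \<times>\<times> F\<^esub> y =
        y \<otimes>\<^bsub>int_vectors I \<times>\<times> F\<^esub> x [^]\<^bsub>int_vectors I \<times>\<times> F\<^esub> K"
      unfolding xy int_vectors_DirProd_pow[OF cl(1,2)] using cl(4) by (auto simp: algebra_simps)
  qed
qed

lemma carrier_int_mod_vectors: "carrier (int_mod_vectors K I \<times>\<times> F) = (I \<rightarrow>\<^sub>E {0..<int K}) \<times> carrier F"
  using K by (simp add: carrier_integer_mod_group)

lemma card_int_mod_vectors:
  "finite I \<Longrightarrow> card (carrier (int_mod_vectors K I \<times>\<times> F)) = K ^ card I * card (carrier F)"
  unfolding carrier_int_mod_vectors by (simp add: card_cartesian_product card_PiE)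

lemma finite_int_mod_vectors: "finite I \<Longrightarrow> finite (carrier (int_mod_vectors K I \<times>\<times> F))"
  unfolding carrier_int_mod_vectors using F(2) by (intro finite_cartesian_product finite_PiE) auto

lemma pow_int_mod_vectors:
  assumes "(v, f) \<in> carrier (int_mod_vectors K I \<times>\<times> F)"
  shows "(v, f) [^]\<^bsub>int_mod_vectors K I \<times>\<times> F\<^esub> (m::nat) = (\<lambda>i\<in>I. (int m * v i) mod int K, f [^]\<^bsub>F\<^esub> m)"
  using nat_pow_product_group[of I "\<lambda>_. integer_mod_group K" v m] assms
  by (simp add: nat_pow_DirProd)

lemma pow_exponent_int_mod_vectors:
  assumes "x \<in> carrier (int_mod_vectors K I \<times>\<times> F)"
  shows "x [^]\<^bsub>int_mod_vectors K I \<times>\<times> F\<^esub> K = \<one>\<^bsub>int_mod_vectors K I \<times>\<times> F\<^esub>"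
  using assms pow_int_mod_vectors[of "fst x" "snd x" K] F.pow_eq_one_of_card_dvd[OF F(2) K(2), of "snd x"]
  by (cases x) simp

lemma reduce_mod_hom: "reduce_mod K I \<in> hom (int_vectors I \<times>\<times> F) (int_mod_vectors K I \<times>\<times> F)"
proof (rule homI)
  fix x y assume "x \<in> carrier (int_vectors I \<times>\<times> F)" "y \<in> carrier (int_vectors I \<times>\<times> F)"
  then show "reduce_mod K I x \<in> carrier (int_mod_vectors K I \<times>\<times> F)"
    unfolding carrier_int_mod_vectors using K by (auto simp: reduce_mod_def)
  show "reduce_mod K I (x \<otimes>\<^bsub>int_vectors I \<times>\<times> F\<^esub> y)
      = reduce_mod K I x \<otimes>\<^bsub>int_mod_vectors K I \<times>\<times> F\<^esub> reduce_mod K I y"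
    by (auto simp: reduce_mod_def mult_DirProd' mod_add_eq)
qed

lemma reduce_mod_onto:
  "reduce_mod K I ` carrier (int_vectors I \<times>\<times> F) = carrier (int_mod_vectors K I \<times>\<times> F)"
proof
  show "carrier (int_mod_vectors K I \<times>\<times> F) \<subseteq> reduce_mod K I ` carrier (int_vectors I \<times>\<times> F)"
  proof
    fix x assume x: "x \<in> carrier (int_mod_vectors K I \<times>\<times> F)"
    then have "reduce_mod K I x = x"
      unfolding carrier_int_mod_vectors
      by (cases x) (auto simp: reduce_mod_def fun_eq_iff PiE_iff extensional_def)
    moreover have "x \<in> carrier (int_vectors I \<times>\<times> F)"
      using x by (auto simp: PiE_iff)
    ultimately show "x \<in> reduce_mod K I ` carrier (int_vectors I \<times>\<times> F)"
      by (metis image_eqI)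
  qed
qed (use hom_carrier[OF reduce_mod_hom] in blast)

text \<open>Both sides consist of the vectors divisible by \<open>K\<close> paired with the identity
  of \<open>F\<close>. Thus reduction realises the quotient by \<open>K\<close>-th powers
  concretely.\<close>

lemma kernel_reduce_mod:
  "kernel (int_vectors I \<times>\<times> F) (int_mod_vectors K I \<times>\<times> F) (reduce_mod K I) = power_set (int_vectors I \<times>\<times> F) K"
proof (intro equalityI subsetI)
  fix x assume "x \<in> kernel (int_vectors I \<times>\<times> F) (int_mod_vectors K I \<times>\<times> F) (reduce_mod K I)"
  then have x: "x \<in> carrier (int_vectors I \<times>\<times> F)" and "reduce_mod K I x = \<one>\<^bsub>int_mod_vectors K I \<times>\<times> F\<^esub>"
    by (simp_all add: kernel_def)
  then have snd: "snd x = \<one>\<^bsub>F\<^esub>" and "(\<lambda>i\<in>I. fst x i mod int K) = (\<lambda>i\<in>I. 0)"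
    by (simp_all add: reduce_mod_def)
  then have dvd: "fst x i mod int K = 0" if "i \<in> I" for i
    using that by (metis restrict_apply')
  define v where "v = (\<lambda>i\<in>I. fst x i div int K)"
  have v: "v \<in> carrier (int_vectors I)"
    by (simp add: v_def)
  have "fst x = (\<lambda>i\<in>I. int K * v i)"
    using x dvd by (auto simp: v_def fun_eq_iff PiE_iff extensional_def mod_eq_0_iff_dvd)
  then have "x = (v, \<one>\<^bsub>F\<^esub>) [^]\<^bsub>int_vectors I \<times>\<times> F\<^esub> K"
    using snd by (simp add: int_vectors_DirProd_pow[OF v] prod_eq_iff)
  then show "x \<in> power_set (int_vectors I \<times>\<times> F) K"
    using v by (auto simp: power_set_def)
next
  fix x assume "x \<in> power_set (int_vectors I \<times>\<times> F) K"
  then obtain v f where vf: "v \<in> carrier (int_vectors I)" "f \<in> carrier F"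
    and x: "x = (v, f) [^]\<^bsub>int_vectors I \<times>\<times> F\<^esub> K"
    by (auto simp: power_set_def)
  then show "x \<in> kernel (int_vectors I \<times>\<times> F) (int_mod_vectors K I \<times>\<times> F) (reduce_mod K I)"
    unfolding x int_vectors_DirProd_pow[OF vf] by (auto simp: kernel_def reduce_mod_def)
qed

end

section \<open>Identifying the quotient by powers through counting\<close>

lemma card_mod_kernel:
  assumes "group G" "group Q" "\<phi> \<in> hom G Q" "\<phi> ` carrier G = carrier Q" "kernel G Q \<phi> = N"
  shows "card (carrier (G Mod N)) = card (carrier Q)"
proof -
  interpret group_hom G Q \<phi>
    using assms by (simp add: group_hom_def group_hom_axioms_def)
  show ?thesis
    using iso_same_card[OF FactGroup_iso[OF assms(4)]] assms(5) by simp
qed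

text \<open>Each inclusion of configuration sets is used once. \<open>G\<close> modulo
  \<open>k\<close>-th powers is a quotient of \<open>H\<close>, and since \<open>k\<close> kills it,
  it is no larger than \<open>Q\<close>. Conversely \<open>Q\<close> is a quotient of
  \<open>G\<close> killed by \<open>k\<close>, hence an image of \<open>G\<close> modulo powers, and
  counting makes that map bijective.\<close>

lemma Con_quotient_by_powers:
  assumes "Con G = Con H" "group G" "group H" "generating_sequence G gs"
    and "central_power G k" "finite (carrier (G Mod power_set G k))"
    and "group Q" "finite (carrier Q)" "\<forall>x\<in>carrier Q. x [^]\<^bsub>Q\<^esub> k = \<one>\<^bsub>Q\<^esub>"
    and "q \<in> hom H Q" "q ` carrier H = carrier Q" "kernel H Q q = power_set H k"
  shows "\<exists>\<phi>\<in>hom G Q. \<phi> ` carrier G = carrier Q \<and> kernel G Q \<phi> = power_set G k"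
proof -
  interpret G: group G by fact
  interpret H: group H by fact
  interpret Q: group Q by fact
  define N where "N = power_set G k"
  interpret N: normal N G
    unfolding N_def by (rule G.power_set_normal) fact
  have subN: "subgroup N G"
    by (rule normal_imp_subgroup) (rule N.normal_axioms)
  define M where "M = G Mod N"
  have M: "group M"
    unfolding M_def by (rule N.factorgroup_is_group)
  interpret M: group M by fact
  have finM: "finite (carrier M)"
    using assms(6) by (simp add: M_def N_def)
  have carrierM: "carrier M = (\<lambda>x. N #>\<^bsub>G\<^esub> x) ` carrier G"
    by (simp add: M_def carrier_FactGroup)
  have Mexp: "z [^]\<^bsub>M\<^esub> k = \<one>\<^bsub>M\<^esub>" if z: "z \<in> carrier M" for z
  proof -
    obtain x where x: "x \<in> carrier G" "z = N #>\<^bsub>G\<^esub> x"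
      using z carrierM by blast
    have "z [^]\<^bsub>M\<^esub> k = N #>\<^bsub>G\<^esub> (x [^]\<^bsub>G\<^esub> k)"
      using N.FactGroup_pow[OF x(1)] x(2) by (simp add: M_def)
    also have "\<dots> = N"
      using x(1) by (intro G.coset_join2[OF _ subN]) (auto simp: N_def power_set_def)
    finally show ?thesis
      by (simp add: M_def)
  qed
  obtain gs' where gs': "generating_sequence H gs'"
    by (rule Con_generating_sequence[OF equalityD1[OF assms(1)] assms(2-4)])
  have proj: "(\<lambda>x. N #>\<^bsub>G\<^esub> x) \<in> hom G M"
    unfolding M_def by (rule N.r_coset_hom_Mod)
  obtain \<psi> where \<psi>: "\<psi> \<in> hom H M" "\<psi> ` carrier H = carrier M"
    using Con_finite_quotient_transfer[OF equalityD1[OF assms(1)] assms(2-4) M finM proj carrierM[symmetric]]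
    by blast
  interpret \<psi>: group_hom H M \<psi>
    using \<psi> by (simp add: group_hom_def group_hom_axioms_def M assms(3))
  interpret q: group_hom H Q q
    using assms by (simp add: group_hom_def group_hom_axioms_def)
  \<comment> \<open>\<open>\<psi>\<close> factors through \<open>q\<close>: elements with the same
    image under \<open>q\<close> differ by a \<open>k\<close>-th power, which becomes trivial in
    \<open>M\<close>.\<close>
  have "\<psi> x = \<psi> y" if xy: "x \<in> carrier H" "y \<in> carrier H" "q x = q y" for x y
  proof -
    have "q (x \<otimes>\<^bsub>H\<^esub> inv\<^bsub>H\<^esub> y) = q y \<otimes>\<^bsub>Q\<^esub> inv\<^bsub>Q\<^esub> q y"
      using xy by (simp only: q.hom_mult q.hom_inv H.inv_closed)
    also have "\<dots> = \<one>\<^bsub>Q\<^esub>"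
      by (rule Q.r_inv) (rule q.hom_closed[OF xy(2)])
    finally have "x \<otimes>\<^bsub>H\<^esub> inv\<^bsub>H\<^esub> y \<in> kernel H Q q"
      using xy(1,2) by (simp only: kernel_def mem_Collect_eq H.inv_closed H.m_closed)
    then have "x \<otimes>\<^bsub>H\<^esub> inv\<^bsub>H\<^esub> y \<in> power_set H k"
      unfolding assms(12) .
    then obtain z where z: "z \<in> carrier H" "x \<otimes>\<^bsub>H\<^esub> inv\<^bsub>H\<^esub> y = z [^]\<^bsub>H\<^esub> k"
      by (auto simp: power_set_def)
    have "\<psi> x \<otimes>\<^bsub>M\<^esub> inv\<^bsub>M\<^esub> \<psi> y = \<psi> (x \<otimes>\<^bsub>H\<^esub> inv\<^bsub>H\<^esub> y)"
      using xy(1,2) by simp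
    also have "\<dots> = \<one>\<^bsub>M\<^esub>"
      unfolding z(2) using z(1) Mexp by (simp add: \<psi>.hom_nat_pow)
    finally show ?thesis
      using xy(1,2) M.inv_equality[of "\<psi> x" "inv\<^bsub>M\<^esub> \<psi> y"] by simp
  qed
  then have card_le: "card (carrier M) \<le> card (carrier Q)"
    unfolding \<psi>(2)[symmetric] using assms(8,11)
    by (intro card_image_le_key(2)[of "carrier H" q \<psi>]) blast+
  obtain \<phi> where \<phi>: "\<phi> \<in> hom G Q" "\<phi> ` carrier G = carrier Q"
    using Con_finite_quotient_transfer[OF equalityD2[OF assms(1)] assms(3,2) gs' assms(7,8,10,11)]
    by blast
  interpret \<phi>: group_hom G Q \<phi>
    using \<phi> by (simp add: group_hom_def group_hom_axioms_def assms)
  have N_ker: "\<phi> z = \<one>\<^bsub>Q\<^esub>" if "z \<in> N" for z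
    using that assms(9) by (auto simp: N_def power_set_def \<phi>.hom_nat_pow)
  have "N \<subseteq> kernel G Q \<phi>"
    using N_ker N.subset by (auto simp: kernel_def)
  then obtain g where g: "g \<in> hom M Q" "\<And>x. x \<in> carrier G \<Longrightarrow> g (N #>\<^bsub>G\<^esub> x) = \<phi> x"
    unfolding M_def by (rule \<phi>.FactGroup_universal_kernel[OF N.normal_axioms]) blast
  have g_onto: "g ` carrier M = carrier Q"
    unfolding carrierM \<phi>(2)[symmetric] using g(2) by (auto simp: image_image)
  \<comment> \<open>A surjection from a finite set onto a set at least as large is
    injective.\<close>
  then have "card (g ` carrier M) = card (carrier M)"
    using card_le card_image_le[OF finM, of g] by simp
  then have inj: "inj_on g (carrier M)"
    by (rule eq_card_imp_inj_on[OF finM])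
  have "x \<in> N" if x: "x \<in> carrier G" "\<phi> x = \<one>\<^bsub>Q\<^esub>" for x
  proof -
    have "g (N #>\<^bsub>G\<^esub> x) = g (N #>\<^bsub>G\<^esub> \<one>\<^bsub>G\<^esub>)"
      using g(2) x by simp
    then have "N #>\<^bsub>G\<^esub> x = N #>\<^bsub>G\<^esub> \<one>\<^bsub>G\<^esub>"
      using inj x(1) unfolding inj_on_def carrierM by blast
    then show ?thesis
      using G.rcos_self[OF x(1) subN] N.subset by (simp add: G.coset_mult_one)
  qed
  then have "kernel G Q \<phi> = N"
    using N_ker N.subset by (auto simp: kernel_def)
  with \<phi> show ?thesis
    unfolding N_def by blast
qed

section \<open>The isomorphism\<close>

lemma int_vectors_iso_reindex:
  assumes "bij_betw b I J"
  shows "int_vectors J \<cong> int_vectors I"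
proof -
  define h where "h v = (\<lambda>i\<in>I. v (b i) :: int)" for v
  define h' where "h' w = (\<lambda>j\<in>J. w (inv_into I b j) :: int)" for w
  have "h \<in> hom (int_vectors J) (int_vectors I)"
    using bij_betwE[OF assms] by (intro homI) (auto simp: h_def fun_eq_iff)
  moreover have "bij_betw h (carrier (int_vectors J)) (carrier (int_vectors I))"
  proof (rule bij_betw_byWitness[where f' = h'])
    show "\<forall>v\<in>carrier (int_vectors J). h' (h v) = v"
      using bij_betw_inv_into_right[OF assms] bij_betwE[OF bij_betw_inv_into[OF assms]]
      by (auto simp: h_def h'_def fun_eq_iff PiE_iff extensional_def)
    show "\<forall>w\<in>carrier (int_vectors I). h (h' w) = w"
      using bij_betw_inv_into_left[OF assms] bij_betwE[OF assms]
      by (auto simp: h_def h'_def fun_eq_iff PiE_iff extensional_def)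
  qed (auto simp: h_def h'_def)
  ultimately show ?thesis
    by (auto simp: is_iso_def iso_def)
qed

lemma DirProd_iso_left:
  assumes "A \<cong> B" "group A" "group F"
  shows "A \<times>\<times> F \<cong> B \<times>\<times> F"
proof -
  obtain h where "h \<in> iso A B"
    using assms(1) by (auto simp: is_iso_def)
  moreover have "id \<in> iso F F"
    by (auto simp: iso_def hom_def bij_betw_def)
  ultimately have "(\<lambda>(x, y). (h x, id y)) \<in> iso (A \<times>\<times> F) (B \<times>\<times> F)"
    using iso_paired2[OF assms(2,3)] by blast
  then show ?thesis
    by (auto simp: is_iso_def)
qed

text \<open>Write \<open>K = k\<^sup>2\<close>. The elements of \<open>(\<int>/K)\<^sup>I \<times> F\<close> killed by \<open>k\<close> form \<open>(k\<int>/K)\<^sup>I \<times> F\<close>, and those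
  of them with trivial \<open>F\<close>-component are \<open>k\<close>-th powers; hence the \<open>F\<close>-component of \<open>\<phi>\<close> restricts to a
  bijection from the torsion of \<open>G\<close> onto \<open>F\<close>.\<close>

lemma iso_power_set_DirProd:
  assumes "group G" "group F" "finite (carrier F)" "card (carrier F) dvd k" "0 < k"
    and cp: "central_power G k"
    and torsion: "\<forall>x\<in>carrier G. \<forall>m>0. x [^]\<^bsub>G\<^esub> (m::nat) = \<one>\<^bsub>G\<^esub> \<longrightarrow> x [^]\<^bsub>G\<^esub> k = \<one>\<^bsub>G\<^esub>"
    and \<phi>: "\<phi> \<in> hom G (int_mod_vectors (k * k) I \<times>\<times> F)"
      "\<phi> ` carrier G = carrier (int_mod_vectors (k * k) I \<times>\<times> F)"
      "kernel G (int_mod_vectors (k * k) I \<times>\<times> F) \<phi> = power_set G (k * k)"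
  shows "G \<cong> G\<lparr>carrier := power_set G k\<rparr> \<times>\<times> F"
proof -
  interpret G: group G by fact
  interpret F: group F by fact
  define K where "K = k * k"
  define Q where "Q = int_mod_vectors K I \<times>\<times> F"
  have K: "0 < K" "card (carrier F) dvd K"
    using assms(4,5) by (auto simp: K_def)
  have "group Q"
    unfolding Q_def by (intro DirProd_group assms(2)) simp
  then interpret \<phi>: group_hom G Q \<phi>
    using \<phi>(1) by (simp add: group_hom_def group_hom_axioms_def assms(1) Q_def K_def)
  note \<phi> = \<phi>[folded K_def, folded Q_def]
  have carrierQ: "carrier Q = (I \<rightarrow>\<^sub>E {0..<int K}) \<times> carrier F"
    unfolding Q_def using K(1) by (simp add: carrier_integer_mod_group)
  have powQ: "(v, f) [^]\<^bsub>Q\<^esub> k = (\<lambda>i\<in>I. (int k * v i) mod int K, \<one>\<^bsub>F\<^esub>)"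
    if "(v, f) \<in> carrier Q" for v f
    using pow_int_mod_vectors[OF assms(2,3) K, of v f I k] that
      F.pow_eq_one_of_card_dvd[OF assms(3,4), of f] by (simp add: Q_def)
  have oneQ: "\<one>\<^bsub>Q\<^esub> = (\<lambda>i\<in>I. 0, \<one>\<^bsub>F\<^esub>)"
    by (simp add: Q_def)
  define \<psi> where "\<psi> = snd \<circ> \<phi>"
  have "snd \<in> hom Q F"
    by (auto intro!: homI simp: mult_DirProd' Q_def)
  then have \<psi>_hom: "\<psi> \<in> hom G F"
    unfolding \<psi>_def using \<phi>(1) by (intro hom_compose)
  interpret \<psi>: group_hom G F \<psi>
    using \<psi>_hom by (simp add: group_hom_def group_hom_axioms_def assms)
  have powK: "y [^]\<^bsub>G\<^esub> K = (y [^]\<^bsub>G\<^esub> k) [^]\<^bsub>G\<^esub> k" if "y \<in> carrier G" for y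
    using that by (simp add: K_def G.nat_pow_pow)
  have ker: "\<exists>y\<in>carrier G. x = (y [^]\<^bsub>G\<^esub> k) [^]\<^bsub>G\<^esub> k" if x: "x \<in> carrier G" "\<phi> x = \<one>\<^bsub>Q\<^esub>" for x
  proof -
    have "x \<in> power_set G K"
      using \<phi>(3) x by (auto simp: kernel_def)
    then show ?thesis
      using powK by (auto simp: power_set_def)
  qed
  have inj: "x = \<one>\<^bsub>G\<^esub>" if x: "x \<in> carrier G" "x [^]\<^bsub>G\<^esub> k = \<one>\<^bsub>G\<^esub>" "\<psi> x = \<one>\<^bsub>F\<^esub>" for x
  proof -
    obtain v where v: "\<phi> x = (v, \<one>\<^bsub>F\<^esub>)"
      using x(3) by (cases "\<phi> x") (simp add: \<psi>_def)
    have vQ: "(v, \<one>\<^bsub>F\<^esub>) \<in> carrier Q"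
      using \<phi>.hom_closed[OF x(1)] v by simp
    have "(v, \<one>\<^bsub>F\<^esub>) [^]\<^bsub>Q\<^esub> k = \<one>\<^bsub>Q\<^esub>"
      using \<phi>.hom_nat_pow[OF x(1), of k] x(2) v by simp
    then have "(\<lambda>i\<in>I. (int k * v i) mod int K) = (\<lambda>i\<in>I. 0)"
      unfolding powQ[OF vQ] oneQ by simp
    then have "int k * v i mod int K = 0" if "i \<in> I" for i
      using that by (metis restrict_apply')
    \<comment> \<open>With modulus \<open>k * k\<close>, a coordinate killed by \<open>k\<close> is
      itself a multiple of \<open>k\<close>. This is why the square of \<open>k\<close> is the
      modulus.\<close>
    then have dvd: "int k dvd v i" if "i \<in> I" for i
      using that assms(5) by (auto simp: K_def mod_eq_0_iff_dvd)
    define u where "u = (\<lambda>i\<in>I. v i div int k)"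
    have range: "0 \<le> v i" "v i < int K" if "i \<in> I" for i
      using vQ that by (auto simp: carrierQ)
    have "v i div int k \<le> v i" if "i \<in> I" for i
      using zdiv_mono2[of "v i" 1 "int k"] range[OF that] assms(5) by simp
    then have uQ: "(u, \<one>\<^bsub>F\<^esub>) \<in> carrier Q"
      using range assms(5) by (fastforce simp: carrierQ u_def pos_imp_zdiv_nonneg_iff)
    have "(\<lambda>i\<in>I. (int k * u i) mod int K) = v"
      using vQ range dvd by (auto simp: u_def fun_eq_iff carrierQ PiE_iff extensional_def)
    then have "(u, \<one>\<^bsub>F\<^esub>) [^]\<^bsub>Q\<^esub> k = \<phi> x"
      unfolding powQ[OF uQ] v by simp
    moreover obtain y where y: "y \<in> carrier G" "\<phi> y = (u, \<one>\<^bsub>F\<^esub>)"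
      using \<phi>(2) uQ by (metis image_iff)
    ultimately have "\<phi> x = \<phi> (y [^]\<^bsub>G\<^esub> k)"
      by (simp add: \<phi>.hom_nat_pow)
    then have "\<phi> (inv\<^bsub>G\<^esub> (y [^]\<^bsub>G\<^esub> k) \<otimes>\<^bsub>G\<^esub> x) = \<one>\<^bsub>Q\<^esub>"
      using x(1) y(1) by simp
    then obtain z where z: "z \<in> carrier G"
      "inv\<^bsub>G\<^esub> (y [^]\<^bsub>G\<^esub> k) \<otimes>\<^bsub>G\<^esub> x = (z [^]\<^bsub>G\<^esub> k) [^]\<^bsub>G\<^esub> k"
      using ker[of "inv\<^bsub>G\<^esub> (y [^]\<^bsub>G\<^esub> k) \<otimes>\<^bsub>G\<^esub> x"] x(1) y(1) by auto
    \<comment> \<open>\<open>x\<close> equals \<open>y [^] k\<close> times a \<open>k * k\<close>-th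
      power, so \<open>x\<close> is the \<open>k\<close>-th power of \<open>t\<close>. As
      \<open>x\<close> has finite order, so has \<open>t\<close>, and the torsion bound kills
      \<open>t [^] k\<close>, which is \<open>x\<close>.\<close>
    define t where "t = y \<otimes>\<^bsub>G\<^esub> z [^]\<^bsub>G\<^esub> k"
    have t: "t \<in> carrier G"
      using y z by (simp add: t_def)
    have "x = y [^]\<^bsub>G\<^esub> k \<otimes>\<^bsub>G\<^esub> (z [^]\<^bsub>G\<^esub> k) [^]\<^bsub>G\<^esub> k"
      unfolding z(2)[symmetric] using x(1) y(1) by (simp add: G.m_assoc[symmetric])
    also have "\<dots> = t [^]\<^bsub>G\<^esub> k"
      unfolding t_def using y(1) z(1) by (intro G.central_powerD(1)[OF cp, symmetric]) auto
    finally have xt: "x = t [^]\<^bsub>G\<^esub> k" .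
    then have "t [^]\<^bsub>G\<^esub> (k * k) = \<one>\<^bsub>G\<^esub>"
      using x(2) t by (simp add: G.nat_pow_pow)
    then have "t [^]\<^bsub>G\<^esub> k = \<one>\<^bsub>G\<^esub>"
      using torsion t assms(5) by (metis nat_0_less_mult_iff)
    then show ?thesis
      using xt by simp
  qed
  have surj: "\<exists>t\<in>carrier G. t [^]\<^bsub>G\<^esub> k = \<one>\<^bsub>G\<^esub> \<and> \<psi> t = f" if f: "f \<in> carrier F" for f
  proof -
    have fQ: "(\<lambda>i\<in>I. 0, f) \<in> carrier Q"
      using f K(1) by (simp add: carrierQ)
    then obtain x where x: "x \<in> carrier G" "\<phi> x = (\<lambda>i\<in>I. 0, f)"
      using \<phi>(2) by (metis image_iff)
    have "\<phi> (x [^]\<^bsub>G\<^esub> k) = \<one>\<^bsub>Q\<^esub>"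
      unfolding \<phi>.hom_nat_pow[OF x(1)] x(2) powQ[OF fQ] oneQ by (simp add: fun_eq_iff)
    then obtain y where y: "y \<in> carrier G" "x [^]\<^bsub>G\<^esub> k = (y [^]\<^bsub>G\<^esub> k) [^]\<^bsub>G\<^esub> k"
      using ker[of "x [^]\<^bsub>G\<^esub> k"] x(1) by auto
    \<comment> \<open>A preimage \<open>x\<close> of \<open>f\<close> is corrected to have trivial
      \<open>k\<close>-th power. The correction is a \<open>k\<close>-th power, hence invisible in
      \<open>F\<close>, whose order divides \<open>k\<close>.\<close>
    define t where "t = x \<otimes>\<^bsub>G\<^esub> inv\<^bsub>G\<^esub> (y [^]\<^bsub>G\<^esub> k)"
    have t: "t \<in> carrier G"
      using x y by (simp add: t_def)
    have "t [^]\<^bsub>G\<^esub> k = x [^]\<^bsub>G\<^esub> k \<otimes>\<^bsub>G\<^esub> (inv\<^bsub>G\<^esub> (y [^]\<^bsub>G\<^esub> k)) [^]\<^bsub>G\<^esub> k"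
      unfolding t_def using x(1) y(1) by (intro G.central_powerD(1)[OF cp]) auto
    also have "\<dots> = \<one>\<^bsub>G\<^esub>"
      unfolding y(2) using y(1) by (simp add: G.nat_pow_inv)
    finally have "t [^]\<^bsub>G\<^esub> k = \<one>\<^bsub>G\<^esub>" .
    moreover have "\<psi> t = f"
    proof -
      have "\<psi> x = f"
        using x(2) by (simp add: \<psi>_def)
      moreover have "\<psi> (y [^]\<^bsub>G\<^esub> k) = \<one>\<^bsub>F\<^esub>"
        using F.pow_eq_one_of_card_dvd[OF assms(3,4), of "\<psi> y"] y(1) by (simp add: \<psi>.hom_nat_pow)
      ultimately show ?thesis
        using x(1) y(1) f by (simp add: t_def)
    qed
    ultimately show ?thesis
      using t by blast
  qed
  define B where "B = G\<lparr>carrier := power_set G k\<rparr>"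
  define \<Phi> where "\<Phi> x = (x [^]\<^bsub>G\<^esub> k, \<psi> x)" for x
  have "group B"
    unfolding B_def using G.power_set_comm_group[OF cp] by (simp add: comm_group_def)
  then have group: "group (B \<times>\<times> F)"
    using assms(2) by (rule DirProd_group)
  have hom: "\<Phi> \<in> hom G (B \<times>\<times> F)"
  proof (rule homI)
    fix x y assume xy: "x \<in> carrier G" "y \<in> carrier G"
    show "\<Phi> x \<in> carrier (B \<times>\<times> F)"
      using xy by (simp add: \<Phi>_def B_def power_set_def)
    show "\<Phi> (x \<otimes>\<^bsub>G\<^esub> y) = \<Phi> x \<otimes>\<^bsub>B \<times>\<times> F\<^esub> \<Phi> y"
      using xy G.central_powerD(1)[OF cp xy] by (simp add: \<Phi>_def B_def)
  qed
  interpret \<Phi>: group_hom G "B \<times>\<times> F" \<Phi>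
    using hom group by (simp add: group_hom_def group_hom_axioms_def assms(1))
  have "inj_on \<Phi> (carrier G)"
    unfolding \<Phi>.inj_on_one_iff using inj by (auto simp: \<Phi>_def B_def)
  moreover have "\<Phi> ` carrier G = carrier (B \<times>\<times> F)"
  proof
    show "carrier (B \<times>\<times> F) \<subseteq> \<Phi> ` carrier G"
    proof
      fix p assume "p \<in> carrier (B \<times>\<times> F)"
      then obtain y f where y: "y \<in> carrier G" and f: "f \<in> carrier F" and p: "p = (y [^]\<^bsub>G\<^esub> k, f)"
        by (auto simp: B_def power_set_def)
      \<comment> \<open>A torsion element \<open>t\<close> adjusts the \<open>F\<close>-component of
        \<open>y\<close> without changing its \<open>k\<close>-th power.\<close>
      obtain t where t: "t \<in> carrier G" "t [^]\<^bsub>G\<^esub> k = \<one>\<^bsub>G\<^esub>" "\<psi> t = inv\<^bsub>F\<^esub> \<psi> y \<otimes>\<^bsub>F\<^esub> f"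
        using surj[of "inv\<^bsub>F\<^esub> \<psi> y \<otimes>\<^bsub>F\<^esub> f"] f y by auto
      have "\<Phi> (y \<otimes>\<^bsub>G\<^esub> t) = p"
        using y t f G.central_powerD(1)[OF cp y t(1)] by (simp add: \<Phi>_def p F.m_assoc[symmetric])
      then show "p \<in> \<Phi> ` carrier G"
        using y t(1) by (metis G.m_closed image_eqI)
    qed
  qed (use hom_carrier[OF hom] in blast)
  ultimately show ?thesis
    using hom by (auto simp: is_iso_def iso_def bij_betw_def B_def)
qed

section \<open>Choice of the exponent, the splitting of \<open>G\<close>, and comparison of
  ranks\<close>

theorem theorem3p5:
  fixes n :: nat
    and F :: "('f, 'p) monoid_scheme"
    and G :: "('g, 'q) monoid_scheme"
  assumes "n > 0"
    and "group F" and "finite (carrier F)"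
    and "finitely_generated_group G"
    and "Con G = Con (int_power_group n \<times>\<times> F)"
  shows "G \<cong> int_power_group n \<times>\<times> F"
proof -
  define I where "I = {1..n}"
  have I: "finite I" "card I = n"
    by (simp_all add: I_def)
  define H where "H = int_vectors I \<times>\<times> F"
  have H_eq: "int_power_group n \<times>\<times> F = H"
    by (simp add: H_def int_power_group_def I_def)
  obtain gs where gs: "generating_sequence G gs" and "group G"
    using assms(4) by (auto simp: finitely_generated_group_def)
  interpret G: group G by fact
  interpret F: group F by fact
  have "group H"
    unfolding H_def by (intro DirProd_group assms(2)) simp
  have Con: "Con G = Con H"
    using assms(5) H_eq by simp
  define k0 where "k0 = card (carrier F)"
  have "0 < k0"
    using assms(3) F.one_closed by (auto simp: k0_def card_gt_0_iff)
  have cp: "central_power G k" if "0 < k" "k0 dvd k" for k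
    using Con_central_power[OF equalityD1[OF Con] \<open>group G\<close> \<open>group H\<close> gs]
      central_power_int_vectors[OF assms(2,3) that(1) that(2)[unfolded k0_def], of I] by (simp add: H_def)
  let ?Z = "int_vectors {..<length gs}"
  define A where "A = G\<lparr>carrier := power_set G k0\<rparr>"
  have cp0: "central_power G k0"
    using \<open>0 < k0\<close> by (intro cp) auto
  have "group A"
    unfolding A_def using G.power_set_comm_group[OF cp0] by (simp add: comm_group_def)
  obtain \<theta> where \<theta>: "\<theta> \<in> hom ?Z A" "\<theta> ` carrier ?Z = power_set G k0"
    using power_set_image_int_vectors[OF \<open>group G\<close> gs cp0] unfolding A_def by blast
  obtain e :: nat where e: "0 < e" "\<forall>v\<in>carrier ?Z. \<forall>m>0.
      \<theta> v [^]\<^bsub>A\<^esub> (m::nat) = \<one>\<^bsub>A\<^esub> \<longrightarrow> \<theta> v [^]\<^bsub>A\<^esub> e = \<one>\<^bsub>A\<^esub>"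
    using bounded_torsion_image_int_vectors[OF finite_lessThan \<open>group A\<close> \<theta>(1)] by blast
  have powA: "a [^]\<^bsub>A\<^esub> m = a [^]\<^bsub>G\<^esub> m" for a and m :: nat
    unfolding A_def by (rule G.nat_pow_consistent[symmetric])
  \<comment> \<open>The factor \<open>k0\<close> makes \<open>k\<close> a multiple of the order of
    \<open>F\<close>, and \<open>k0 * e\<close> already kills all torsion of \<open>G\<close>. The
    factor 2 ensures \<open>K \<ge> 2\<close>, so that powers of \<open>K\<close> reveal the rank at
    the end.\<close>
  define k where "k = 2 * (k0 * e)"
  have k: "0 < k" "k0 dvd k" "2 \<le> k"
    using \<open>0 < k0\<close> e(1) by (auto simp: k_def)
  have torsion: "x [^]\<^bsub>G\<^esub> k = \<one>\<^bsub>G\<^esub>"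
    if x: "x \<in> carrier G" "0 < m" "x [^]\<^bsub>G\<^esub> (m::nat) = \<one>\<^bsub>G\<^esub>" for x m
  proof -
    obtain v where v: "v \<in> carrier ?Z" "\<theta> v = x [^]\<^bsub>G\<^esub> k0"
      using \<theta>(2) x(1) unfolding power_set_def by (metis (no_types, lifting) image_iff)
    have "(x [^]\<^bsub>G\<^esub> k0) [^]\<^bsub>G\<^esub> m = (x [^]\<^bsub>G\<^esub> m) [^]\<^bsub>G\<^esub> k0"
      using x(1) by (simp add: G.nat_pow_pow mult.commute)
    then have "\<theta> v [^]\<^bsub>A\<^esub> m = \<one>\<^bsub>A\<^esub>"
      using x(3) by (simp add: powA v(2)) (simp add: A_def)
    then have "\<theta> v [^]\<^bsub>A\<^esub> e = \<one>\<^bsub>A\<^esub>"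
      using e(2) v(1) x(2) by blast
    then have "(x [^]\<^bsub>G\<^esub> k0) [^]\<^bsub>G\<^esub> e = \<one>\<^bsub>G\<^esub>"
      by (simp add: powA v(2)) (simp add: A_def)
    then have "x [^]\<^bsub>G\<^esub> (k0 * e) = \<one>\<^bsub>G\<^esub>"
      using x(1) by (simp add: G.nat_pow_pow)
    moreover have "x [^]\<^bsub>G\<^esub> k = (x [^]\<^bsub>G\<^esub> (k0 * e)) [^]\<^bsub>G\<^esub> (2::nat)"
      using x(1) by (simp add: G.nat_pow_pow k_def mult.commute)
    ultimately show ?thesis
      by simp
  qed
  define B where "B = G\<lparr>carrier := power_set G k\<rparr>"
  have "group B"
    unfolding B_def using G.power_set_comm_group[OF cp[OF k(1,2)]] by (simp add: comm_group_def)
  have powB: "a [^]\<^bsub>B\<^esub> m = a [^]\<^bsub>G\<^esub> m" for a and m :: nat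
    unfolding B_def by (rule G.nat_pow_consistent[symmetric])
  \<comment> \<open>If \<open>x [^] k\<close> has finite order, so has \<open>x\<close>, and then
    \<open>x [^] k\<close> is already trivial.\<close>
  have tf: "\<forall>a\<in>carrier B. \<forall>m>0. a [^]\<^bsub>B\<^esub> (m::nat) = \<one>\<^bsub>B\<^esub> \<longrightarrow> a = \<one>\<^bsub>B\<^esub>"
  proof (intro ballI allI impI)
    fix a and m :: nat
    assume a: "a \<in> carrier B" "0 < m" "a [^]\<^bsub>B\<^esub> m = \<one>\<^bsub>B\<^esub>"
    then obtain x where x: "x \<in> carrier G" "a = x [^]\<^bsub>G\<^esub> k"
      by (auto simp: B_def power_set_def)
    have "x [^]\<^bsub>G\<^esub> (k * m) = \<one>\<^bsub>G\<^esub>"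
      using a(3) x unfolding powB by (simp add: G.nat_pow_pow B_def)
    then show "a = \<one>\<^bsub>B\<^esub>"
      using torsion[OF x(1), of "k * m"] a(2) k(1) x(2) by (simp add: B_def)
  qed
  have "carrier B = power_set G k"
    by (simp add: B_def)
  then obtain \<theta>' where \<theta>': "\<theta>' \<in> hom ?Z B" "\<theta>' ` carrier ?Z = carrier B"
    using power_set_image_int_vectors[OF \<open>group G\<close> gs cp[OF k(1,2)], folded B_def] by metis
  have "\<exists>J\<subseteq>{..<length gs}. int_vectors J \<cong> B"
    by (rule torsion_free_imp_iso_int_vectors[OF finite_lessThan \<open>group B\<close> tf \<theta>'])
  then obtain J where J: "J \<subseteq> {..<length gs}" and isoJ: "int_vectors J \<cong> B"
    by blast
  have "finite J"
    using J by (rule finite_subset) simp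
  define K where "K = k * k"
  have K: "0 < K" "card (carrier F) dvd K" "2 \<le> K"
    using k by (auto simp: K_def k0_def intro: order_trans[OF k(3)])
  define Q where "Q = int_mod_vectors K I \<times>\<times> F"
  have groupQ: "group (int_mod_vectors K L \<times>\<times> F)" for L :: "nat set"
    by (intro DirProd_group assms(2)) simp
  have cpK: "central_power G K"
    using cp[OF K(1)] K(2) by (simp add: k0_def)
  have finM: "finite (carrier (G Mod power_set G K))"
  proof (rule Con_finite_mod_powers[OF _ \<open>group G\<close> _ assms(2,3) gs cpK K(1)])
    show "Con G \<subseteq> Con (int_vectors I \<times>\<times> F)"
      using Con by (simp add: H_def)
    show "comm_group (int_vectors I)"
      by (rule group.group_comm_groupI) (auto simp: fun_eq_iff)
  qed
  obtain \<phi> where \<phi>: "\<phi> \<in> hom G Q" "\<phi> ` carrier G = carrier Q" "kernel G Q \<phi> = power_set G K"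
    using Con_quotient_by_powers[OF Con \<open>group G\<close> \<open>group H\<close> gs cpK finM groupQ
        finite_int_mod_vectors[OF assms(2,3) K(1,2) I(1)] _
        reduce_mod_hom[OF assms(2,3) K(1,2), of I, folded H_def]
        reduce_mod_onto[OF assms(2,3) K(1,2), of I, folded H_def]
        kernel_reduce_mod[OF assms(2,3) K(1,2), of I, folded H_def]]
      pow_exponent_int_mod_vectors[OF assms(2,3) K(1,2), of _ I]
    unfolding Q_def by blast
  have "G \<cong> B \<times>\<times> F"
    unfolding B_def
    using iso_power_set_DirProd[OF \<open>group G\<close> assms(2,3) k(2)[unfolded k0_def] k(1) cp[OF k(1,2)]
        _ \<phi>[unfolded Q_def K_def]] torsion by blast
  moreover have groupJ: "group (int_vectors J \<times>\<times> F)"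
    by (intro DirProd_group assms(2)) simp
  moreover have "B \<times>\<times> F \<cong> int_vectors J \<times>\<times> F"
    using isoJ \<open>group B\<close> assms(2) by (intro group.iso_sym[OF groupJ] DirProd_iso_left) auto
  ultimately have isoGJ: "G \<cong> int_vectors J \<times>\<times> F"
    using iso_trans by blast
  then obtain h where h: "h \<in> iso G (int_vectors J \<times>\<times> F)"
    by (auto simp: is_iso_def)
  \<comment> \<open>The splitting gives \<open>G\<close> as a product over the index set
    \<open>J\<close> of still unknown size. Computing \<open>G\<close> modulo \<open>K\<close>-th
    powers from this description and comparing with \<open>Q\<close> determines that size.\<close>
  define QJ where "QJ = int_mod_vectors K J \<times>\<times> F"
  have card_QJ: "card (carrier (G Mod power_set G K)) = card (carrier QJ)"
  proof (rule card_mod_kernel[OF \<open>group G\<close>])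
    let ?r = "reduce_mod K J"
    let ?HJ = "int_vectors J \<times>\<times> F"
    have h_hom: "h \<in> hom G ?HJ" and h_inj: "inj_on h (carrier G)" and h_onto: "h ` carrier G = carrier ?HJ"
      using h by (auto simp: iso_def bij_betw_def)
    interpret h: group_hom G ?HJ h
      using h_hom groupJ by (simp add: group_hom_def group_hom_axioms_def \<open>group G\<close>)
    show "group QJ"
      unfolding QJ_def by (rule groupQ)
    show "?r \<circ> h \<in> hom G QJ"
      unfolding QJ_def using h_hom reduce_mod_hom[OF assms(2,3) K(1,2)] by (rule hom_compose)
    show "(?r \<circ> h) ` carrier G = carrier QJ"
      unfolding QJ_def image_comp[symmetric] h_onto by (rule reduce_mod_onto[OF assms(2,3) K(1,2)])
    have "x \<in> kernel G QJ (?r \<circ> h) \<longleftrightarrow> h x \<in> power_set ?HJ K" if "x \<in> carrier G" for x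
      unfolding kernel_reduce_mod[OF assms(2,3) K(1,2), symmetric]
      using that h.hom_closed[OF that] by (simp only: kernel_def QJ_def mem_Collect_eq o_apply simp_thms)
    moreover have "h x \<in> power_set ?HJ K \<longleftrightarrow> x \<in> power_set G K" if x: "x \<in> carrier G" for x
    proof -
      have "power_set ?HJ K = h ` power_set G K"
        unfolding power_set_def h_onto[symmetric] image_image by (intro image_cong) (simp_all add: h.hom_nat_pow)
      moreover have "power_set G K \<subseteq> carrier G"
        by (auto simp: power_set_def)
      ultimately show ?thesis
        using inj_on_image_mem_iff[OF h_inj x] by simp
    qed
    moreover have "kernel G QJ (?r \<circ> h) \<subseteq> carrier G" "power_set G K \<subseteq> carrier G"
      by (auto simp: kernel_def power_set_def)
    ultimately show "kernel G QJ (?r \<circ> h) = power_set G K"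
      by blast
  qed
  have "card (carrier Q) = card (carrier QJ)"
    using card_mod_kernel[OF \<open>group G\<close> _ \<phi>] groupQ card_QJ by (simp add: Q_def)
  then have "K ^ n * k0 = K ^ card J * k0"
    unfolding Q_def QJ_def card_int_mod_vectors[OF assms(2,3) K(1,2) I(1)]
      card_int_mod_vectors[OF assms(2,3) K(1,2) \<open>finite J\<close>] I(2) k0_def .
  then have "n = card J"
    using \<open>0 < k0\<close> K(3) by simp
  then obtain b where "bij_betw b I J"
    using finite_same_card_bij[OF I(1) \<open>finite J\<close>] I(2) by blast
  then have "int_vectors J \<times>\<times> F \<cong> H"
    unfolding H_def by (intro DirProd_iso_left int_vectors_iso_reindex assms(2)) auto
  then show ?thesis
    unfolding H_eq using isoGJ iso_trans by blast
qed

end
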